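(* Let $H \in \mathbb{C}^{N\times N}$ be a complex matrix and let $S_h \in \mathbb{C}^{N\times N}$ be a family of invertible complex matrices depending smoothly on $h\in \mathbb{R}$ such that (i) the spectrum of $S_h$ satisfies $\sigma(S_h) =\overline{\mathrm{inv}(\sigma(S_h))}$; (ii) $S_h$ is consistent with $\exp(ihH)$, i.e. there exists $p\geq 1$ such that $S_h = e^{ihH} + \mathcal{O}(h^{p+1})$ as $h\to 0$; (iii) the eigenvalues of $H$ are real and simple. Then there exist a family $D_h$ of real diagonal matrices depending smoothly on $h$ and a family $P_h$ of complex invertible matrices depending smoothly on $h$ such that $P_h = P_0 + \mathcal{O}(h^p)$, $D_h = D_0 + \mathcal{O}(h^p)$ and, provided that $|h|$ is small enough, $$S_h = P_h \, e^{ihD_h} \, P_h^{-1}.$$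
   Context: $\sigma(A)$ denotes the set of eigenvalues of a matrix $A$; $\mathrm{inv}: z\mapsto z^{-1}$ is the inverse function on $\mathbb{C}\setminus\{0\}$; for a set $X\subset\mathbb{C}$, $\mathrm{inv}(X)=\{z^{-1}: z\in X\}$ and $\overline{X}=\{\overline{z}: z\in X\}$. $N \ge 1$ and $p\ge 1$ are integers. *)

theory Defs
  imports
    "HOL-Analysis.Analysis"
    "HOL-Computational_Algebra.Polynomial"
    "HOL-Library.Landau_Symbols"
begin

definition eigenvalues :: "'a::field ^ 'n ^ 'n \<Rightarrow> 'a set" where
  "eigenvalues A = {c. \<exists>v. v \<noteq> 0 \<and> A *v v = c *s v}"

text \<open>The characteristic polynomial \<open>det (X I - A)\<close>, a determinant over the polynomial ring.\<close>

definition charpoly :: "'a::comm_ring_1 ^ 'n ^ 'n \<Rightarrow> 'a poly" where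
  "charpoly A = det (mat [:0, 1:] - map_matrix (\<lambda>a. [:a:]) A)"

text \<open>Simple means algebraic multiplicity one.\<close>

definition simple_eigenvalue :: "'a::field ^ 'n ^ 'n \<Rightarrow> 'a \<Rightarrow> bool" where
  "simple_eigenvalue A c \<longleftrightarrow> c \<in> eigenvalues A \<and> order c (charpoly A) = 1"

text \<open>The type class product on \<open>'a ^ 'n ^ 'n\<close>, and hence \<open>(^)\<close>, is entrywise, so powers with respect
  to the matrix product \<open>(**)\<close> are defined separately.\<close>

primrec matrix_pow :: "'a::semiring_1 ^ 'n ^ 'n \<Rightarrow> nat \<Rightarrow> 'a ^ 'n ^ 'n" where
  "matrix_pow A 0 = mat 1"
| "matrix_pow A (Suc k) = A ** matrix_pow A k"

definition matrix_exp :: "complex ^ 'n ^ 'n \<Rightarrow> complex ^ 'n ^ 'n" where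
  "matrix_exp A = (\<Sum>k. matrix_pow A k /\<^sub>R fact k)"

definition diagonal_matrix :: "'a::zero ^ 'n ^ 'n \<Rightarrow> bool" where
  "diagonal_matrix A \<longleftrightarrow> (\<forall>i j. i \<noteq> j \<longrightarrow> A $ i $ j = 0)"

text \<open>\<open>C\<^sup>\<infinity>\<close> on all of \<open>\<real>\<close>: every iterated derivative exists and is differentiable.\<close>

definition smooth :: "(real \<Rightarrow> 'a::real_normed_vector) \<Rightarrow> bool" where
  "smooth f \<longleftrightarrow>
     (\<forall>k x. ((\<lambda>g t. vector_derivative g (at t)) ^^ k) f differentiable (at x))"

end

theory Submission
  imports Defs "HOL-Computational_Algebra.Fundamental_Theorem_Algebra"
begin

text \<open>Write \<open>S\<^sub>h = 1 + i h A(h)\<close>, which is possible with a smooth \<open>A\<close> because consistency forces \<open>S\<^sub>0 = 1\<close>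
and \<open>S'\<^sub>0 = i H\<close>; then \<open>A(0) = H\<close>. All eigenvalues of \<open>S\<^sub>h\<close> meet at \<open>1\<close> as \<open>h \<rightarrow> 0\<close>, but those of \<open>A(h)\<close>
stay apart, because the eigenvalues of \<open>H\<close> are simple. Hence \<open>A(h)\<close> has smooth eigenpairs
\<open>(\<mu>\<^sub>j(h), v\<^sub>j(h))\<close> near those of \<open>H\<close>, and \<open>S\<^sub>h\<close> has the eigenvalues \<open>s\<^sub>j = 1 + i h \<mu>\<^sub>j\<close> with the same
eigenvectors, which form \<open>P\<^sub>h\<close>.

By hypothesis the spectrum is invariant under the reflection \<open>z \<mapsto> 1 / cnj z\<close> in the unit circle. The
reflection of \<open>s\<^sub>j\<close> is \<open>1 + i h \<mu>'\<close> with \<open>\<mu>'\<close> close to \<open>cnj \<lambda>\<^sub>j = \<lambda>\<^sub>j\<close>, and the only eigenvalue of that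
form is \<open>s\<^sub>j\<close> itself. So \<open>s\<^sub>j\<close> is on the circle, and \<open>s\<^sub>j = exp (i \<theta>\<^sub>j)\<close> with
\<open>\<theta>\<^sub>j = Im (Ln s\<^sub>j)\<close> smooth and \<open>\<theta>\<^sub>j(0) = 0\<close>. Dividing by \<open>h\<close> gives the entries \<open>d\<^sub>j = \<theta>\<^sub>j / h\<close> of \<open>D\<^sub>h\<close>,
smooth also at \<open>0\<close>.

For the order estimates, compare \<open>A(h)\<close> with \<open>B(h) = (exp (i h H) - 1) / (i h)\<close>: the two differ by
\<open>O(h\<^sup>p)\<close>, the eigenvectors of \<open>B(h)\<close> are those of \<open>H\<close>, and an eigenpair is a Lipschitz function of the
matrix. So \<open>P\<^sub>h - P\<^sub>0 = O(h\<^sup>p)\<close>, and \<open>\<theta>\<^sub>j - h \<lambda>\<^sub>j = O(h\<^sup>p\<^sup>+\<^sup>1)\<close>, of which one power of \<open>h\<close> is lost in \<open>d\<^sub>j\<close>.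

Eigenpairs are obtained in coordinates in which \<open>H\<close> is diagonal (\<open>diagonalizable_if_simple\<close>), as fixed
points of a contraction (\<open>eigenpair_branch\<close>), which yields existence and the Lipschitz bound together;
smoothness along a curve of matrices follows by solving the differentiated eigenvalue equation with
Cramer's rule and bootstrapping (\<open>smooth_eigenpair\<close>). The families must be smooth on the whole line
although \<open>A(h)\<close> is near \<open>H\<close> only for small \<open>h\<close>, so the argument is run on \<open>A \<circ> \<phi>\<close>, where \<open>\<phi>\<close> is smooth,
takes small values only, and is the identity near \<open>0\<close> (\<open>smooth_truncated_identity\<close>).\<close>

section \<open>Functions of class \<open>C\<^sup>k\<close> on the real line\<close>

text \<open>In contrast to iterating \<open>vector_derivative\<close>, quantifying the derivative existentially lets every closure
property be proved by induction on \<open>k\<close>, from the corresponding rule for one derivative.\<close>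

primrec Ck :: "nat \<Rightarrow> (real \<Rightarrow> 'a::real_normed_vector) \<Rightarrow> bool" where
  "Ck 0 f \<longleftrightarrow> continuous_on UNIV f"
| "Ck (Suc k) f \<longleftrightarrow> (\<exists>f'. (\<forall>x. (f has_vector_derivative f' x) (at x)) \<and> Ck k f')"

lemma Ck_SucI:
  assumes "\<And>x. (f has_vector_derivative f' x) (at x)" and "Ck k f'"
  shows "Ck (Suc k) f"
  using assms by auto

lemma Ck_Suc_imp: "Ck (Suc k) f \<Longrightarrow> Ck k f"
proof (induction k arbitrary: f)
  case 0
  then obtain f' where "\<And>x. (f has_vector_derivative f' x) (at x)" by auto
  then have "isCont f x" for x using has_vector_derivative_continuous by blast
  then show ?case by (simp add: continuous_at_imp_continuous_on)
next
  case (Suc k)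
  obtain f' where "\<And>x. (f has_vector_derivative f' x) (at x)" "Ck (Suc k) f'"
    using Suc.prems unfolding Ck.simps(2)[of "Suc k"] by blast
  with Suc.IH show ?case by (blast intro: Ck_SucI)
qed

lemma Ck_derivative:
  assumes "\<And>k. Ck k f" and f': "\<And>x. (f has_vector_derivative f' x) (at x)"
  shows "Ck k f'"
proof -
  obtain g where g: "\<And>x. (f has_vector_derivative g x) (at x)" "Ck k g"
    using assms(1)[of "Suc k"] unfolding Ck.simps(2) by blast
  have "g = f'" using vector_derivative_unique_at[OF g(1) f'] by (rule ext)
  with g show ?thesis by simp
qed

lemma Ck_imp_continuous: "Ck k f \<Longrightarrow> continuous_on UNIV f"
proof (induction k)
  case (Suc k)
  then show ?case using Ck_Suc_imp by blast
qed simp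

lemma smooth_iff_Ck: "smooth f \<longleftrightarrow> (\<forall>k. Ck k f)"
proof -
  define op :: "(real \<Rightarrow> 'a) \<Rightarrow> real \<Rightarrow> 'a" where "op = (\<lambda>g t. vector_derivative g (at t))"
  have sm: "smooth g \<longleftrightarrow> (\<forall>k x. (op ^^ k) g differentiable (at x))" for g :: "real \<Rightarrow> 'a"
    by (simp add: smooth_def op_def)
  have step: "(op ^^ k) (op g) = (op ^^ Suc k) g" for k g
    by (simp add: funpow_swap1)
  have "Ck k g" if "smooth g" for k and g :: "real \<Rightarrow> 'a"
    using that
  proof (induction k arbitrary: g)
    case 0
    have "g differentiable (at x)" for x
      using 0 unfolding sm by (metis funpow_0)
    then show ?case
      by (auto intro!: continuous_at_imp_continuous_on differentiable_imp_continuous_within)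
  next
    case (Suc k)
    have "g differentiable (at x)" for x
      using Suc.prems unfolding sm by (metis funpow_0)
    then have "\<And>x. (g has_vector_derivative op g x) (at x)"
      by (simp add: op_def flip: vector_derivative_works)
    moreover have "smooth (op g)"
      using Suc.prems unfolding sm step by blast
    ultimately show ?case using Suc.IH by (blast intro: Ck_SucI)
  qed
  moreover have "(op ^^ k) g differentiable (at x)" if "Ck (Suc k) g" for k g x
    using that
  proof (induction k arbitrary: g)
    case 0
    then show ?case by (auto intro: differentiableI_vector)
  next
    case (Suc k)
    obtain g' where g': "\<And>x. (g has_vector_derivative g' x) (at x)" "Ck (Suc k) g'"
      using Suc.prems unfolding Ck.simps(2)[of "Suc k"] by blast
    then have "op g = g'"
      by (auto simp: op_def vector_derivative_at)
    with Suc.IH[OF g'(2)] show ?case by (simp only: step[symmetric])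
  qed
  ultimately show ?thesis unfolding sm by blast
qed

lemma Ck_const [intro]: "Ck k (\<lambda>x. c)"
  by (induction k arbitrary: c) (auto intro!: exI[of _ "\<lambda>x. 0"])

lemma Ck_ident [intro]: "Ck k (\<lambda>x. x)"
  by (cases k) (auto intro!: Ck_SucI[where f' = "\<lambda>x. 1"] simp del: Ck.simps(2))

lemma Ck_add:
  assumes "Ck k f" "Ck k g"
  shows "Ck k (\<lambda>x. f x + g x)"
  using assms
proof (induction k arbitrary: f g)
  case 0
  then show ?case by (auto intro: continuous_intros)
next
  case (Suc k)
  then obtain f' g' where "\<And>x. (f has_vector_derivative f' x) (at x)" "Ck k f'"
    "\<And>x. (g has_vector_derivative g' x) (at x)" "Ck k g'"
    unfolding Ck.simps(2) by blast
  with Suc.IH show ?case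
    by (intro Ck_SucI[where f' = "\<lambda>x. f' x + g' x"]) (auto intro: has_vector_derivative_add)
qed

lemma Ck_bounded_linear:
  assumes L: "bounded_linear L" and "Ck k f"
  shows "Ck k (\<lambda>x. L (f x))"
  using \<open>Ck k f\<close>
proof (induction k arbitrary: f)
  case 0
  then show ?case using L by (auto intro: bounded_linear.continuous_on)
next
  case (Suc k)
  then obtain f' where "\<And>x. (f has_vector_derivative f' x) (at x)" "Ck k f'"
    unfolding Ck.simps(2) by blast
  with Suc.IH show ?case
    by (intro Ck_SucI[where f' = "\<lambda>x. L (f' x)"])
       (auto intro: bounded_linear.has_vector_derivative[OF L])
qed

lemma Ck_bounded_bilinear:
  assumes B: "bounded_bilinear B" and "Ck k f" "Ck k g"
  shows "Ck k (\<lambda>x. B (f x) (g x))"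
  using assms(2,3)
proof (induction k arbitrary: f g)
  case 0
  then show ?case using B by (auto intro: bounded_bilinear.continuous_on)
next
  case (Suc k)
  then obtain f' g' where *: "\<And>x. (f has_vector_derivative f' x) (at x)" "Ck k f'"
    "\<And>x. (g has_vector_derivative g' x) (at x)" "Ck k g'"
    unfolding Ck.simps(2) by blast
  have "Ck k f" "Ck k g" using Suc.prems Ck_Suc_imp by auto
  then have "Ck k (\<lambda>x. B (f x) (g' x) + B (f' x) (g x))"
    using * Suc.IH by (intro Ck_add)
  moreover have "((\<lambda>x. B (f x) (g x)) has_vector_derivative B (f x) (g' x) + B (f' x) (g x)) (at x)" for x
    using * by (intro bounded_bilinear.has_vector_derivative[OF B])
  ultimately show ?case by (rule_tac Ck_SucI)
qed

lemmas Ck_mult = Ck_bounded_bilinear[OF bounded_bilinear_mult]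
lemmas Ck_scaleR = Ck_bounded_bilinear[OF bounded_bilinear_scaleR]

lemma Ck_minus: "Ck k f \<Longrightarrow> Ck k (\<lambda>x. - f x)"
  by (rule Ck_bounded_linear[OF bounded_linear_minus[OF bounded_linear_ident]])

lemma Ck_diff: "Ck k f \<Longrightarrow> Ck k g \<Longrightarrow> Ck k (\<lambda>x. f x - g x)"
  using Ck_add[OF _ Ck_minus, of k f g] by simp

lemma Ck_sum: "(\<And>i. i \<in> I \<Longrightarrow> Ck k (f i)) \<Longrightarrow> Ck k (\<lambda>x. \<Sum>i\<in>I. f i x)"
  by (induction I rule: infinite_finite_induct) (auto intro: Ck_add)

lemma Ck_prod:
  fixes f :: "'i \<Rightarrow> real \<Rightarrow> 'a::real_normed_field"
  shows "(\<And>i. i \<in> I \<Longrightarrow> Ck k (f i)) \<Longrightarrow> Ck k (\<lambda>x. \<Prod>i\<in>I. f i x)"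
  by (induction I rule: infinite_finite_induct) (auto intro: Ck_mult)

lemma Ck_compose:
  assumes "Ck k f" "Ck k g"
  shows "Ck k (\<lambda>x. f (g x))"
  using assms
proof (induction k arbitrary: f)
  case 0
  then show ?case by (auto intro: continuous_on_compose2)
next
  case (Suc k)
  then obtain f' g' where *: "\<And>x. (f has_vector_derivative f' x) (at x)" "Ck k f'"
    "\<And>x. (g has_vector_derivative g' x) (at x)" "Ck k g'"
    unfolding Ck.simps(2) by blast
  have "Ck k g" using Suc.prems Ck_Suc_imp by auto
  then have "Ck k (\<lambda>x. g' x *\<^sub>R f' (g x))"
    using * Suc.IH by (intro Ck_scaleR) auto
  moreover have "((\<lambda>x. f (g x)) has_vector_derivative g' x *\<^sub>R f' (g x)) (at x)" for x
    using vector_diff_chain_at[OF *(3) *(1)] by (simp add: o_def)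
  ultimately show ?case by (rule_tac Ck_SucI)
qed

lemma Ck_inverse:
  fixes f :: "real \<Rightarrow> 'a::real_normed_field"
  assumes "Ck k f" "\<And>x. f x \<noteq> 0"
  shows "Ck k (\<lambda>x. inverse (f x))"
  using assms(1)
proof (induction k)
  case 0
  then show ?case using assms(2) by (auto intro: continuous_intros)
next
  case (Suc k)
  then obtain f' where *: "\<And>x. (f has_vector_derivative f' x) (at x)" "Ck k f'"
    unfolding Ck.simps(2) by blast
  have "Ck k (\<lambda>x. inverse (f x))" using Suc Ck_Suc_imp by auto
  then have "Ck k (\<lambda>x. f' x * - (inverse (f x) * inverse (f x)))"
    using * by (intro Ck_mult Ck_minus)
  moreover have "((\<lambda>x. inverse (f x)) has_vector_derivative
      f' x * - (inverse (f x) * inverse (f x))) (at x)" for x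
    using field_vector_diff_chain_at[OF *(1) DERIV_inverse[OF assms(2)], of x]
    by (simp add: o_def power2_eq_square numeral_2_eq_2)
  ultimately show ?case by (rule_tac Ck_SucI)
qed

lemma Ck_Ln:
  fixes f :: "real \<Rightarrow> complex"
  assumes "Ck k f" "\<And>x. f x \<notin> \<real>\<^sub>\<le>\<^sub>0"
  shows "Ck k (\<lambda>x. Ln (f x))"
proof (cases k)
  case 0
  then show ?thesis using assms by (auto intro!: continuous_on_Ln')
next
  case (Suc m)
  then obtain f' where *: "\<And>x. (f has_vector_derivative f' x) (at x)" "Ck m f'"
    using assms(1) unfolding Suc Ck.simps(2) by blast
  have nz: "f x \<noteq> 0" for x using assms(2)[of x] by auto
  have "Ck m f" using Suc assms(1) Ck_Suc_imp by auto
  then have "Ck m (\<lambda>x. f' x * inverse (f x))"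
    using * nz by (intro Ck_mult Ck_inverse)
  moreover have "((\<lambda>x. Ln (f x)) has_vector_derivative f' x * inverse (f x)) (at x)" for x
    using field_vector_diff_chain_at[OF *(1) has_field_derivative_Ln[OF assms(2)], of x]
    by (simp add: o_def)
  ultimately show ?thesis unfolding Suc by (rule_tac Ck_SucI)
qed

lemma Ck_vec_lambda:
  fixes f :: "'n::finite \<Rightarrow> real \<Rightarrow> 'a::euclidean_space"
  assumes "\<And>i. Ck k (f i)"
  shows "Ck k (\<lambda>x. \<chi> i. f i x)"
proof -
  have "linear (axis i :: 'a \<Rightarrow> 'a ^ 'n)" for i
    by (rule linearI) (simp_all add: vec_eq_iff axis_def)
  then have "bounded_linear (axis i :: 'a \<Rightarrow> 'a ^ 'n)" for i
    by (simp add: linear_conv_bounded_linear)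
  then have "Ck k (\<lambda>x. \<Sum>i\<in>UNIV. axis i (f i x))"
    by (intro Ck_sum Ck_bounded_linear[where L = "axis _"] assms)
  moreover have "(\<Sum>i\<in>UNIV. axis i (f i x)) = (\<chi> i. f i x)" for x
    by (simp add: vec_eq_iff axis_def)
  ultimately show ?thesis by simp
qed

lemma Ck_vec_nth: "Ck k f \<Longrightarrow> Ck k (\<lambda>x. f x $ i)"
  by (rule Ck_bounded_linear[OF bounded_linear_vec_nth])

lemma Ck_det:
  fixes M :: "real \<Rightarrow> 'a::real_normed_field ^ 'n ^ 'n"
  assumes "\<And>i j. Ck k (\<lambda>x. M x $ i $ j)"
  shows "Ck k (\<lambda>x. det (M x))"
  unfolding det_def by (intro Ck_sum Ck_mult Ck_prod Ck_const assms)

section \<open>Division by the variable\<close>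

text \<open>The weights \<open>t\<^sup>m\<close> make the induction on \<open>k\<close> go through: differentiating under the integral sign replaces
\<open>f\<close> by \<open>f'\<close> and \<open>m\<close> by \<open>m + 1\<close>.\<close>

lemma Ck_weighted_average:
  fixes f :: "real \<Rightarrow> 'a::euclidean_space"
  assumes "Ck k f"
  shows "Ck k (\<lambda>h. integral {0..1} (\<lambda>t. t ^ m *\<^sub>R f (t * h)))"
  using assms
proof (induction k arbitrary: f m)
  case 0
  then have c: "continuous_on UNIV f" by simp
  have "continuous_on UNIV (\<lambda>h. integral (cbox 0 1) (\<lambda>t. t ^ m *\<^sub>R f (t * h)))"
    by (rule integral_continuous_on_param)
       (auto intro!: continuous_intros continuous_on_compose2[OF c] simp: split_beta)
  then show ?case by simp
next
  case (Suc k)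
  then obtain f' where *: "\<And>x. (f has_vector_derivative f' x) (at x)" "Ck k f'"
    unfolding Ck.simps(2) by blast
  have c: "continuous_on UNIV f" "continuous_on UNIV f'"
    using Suc.prems *(2) Ck_imp_continuous by blast+
  have der: "((\<lambda>h. t ^ m *\<^sub>R f (t * h)) has_vector_derivative t ^ Suc m *\<^sub>R f' (t * h)) (at h)" for t h
  proof -
    have "((\<lambda>h. t * h) has_vector_derivative t) (at h)"
      by (auto intro!: derivative_eq_intros)
    from vector_diff_chain_at[OF this *(1)]
    have "((\<lambda>h. f (t * h)) has_vector_derivative t *\<^sub>R f' (t * h)) (at h)"
      by (simp add: o_def)
    from bounded_linear.has_vector_derivative[OF bounded_linear_scaleR_right this, of "t ^ m"]
    show ?thesis by (simp add: ac_simps)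
  qed
  have "((\<lambda>h. integral (cbox 0 1) (\<lambda>t. t ^ m *\<^sub>R f (t * h))) has_vector_derivative
      integral (cbox 0 1) (\<lambda>t. t ^ Suc m *\<^sub>R f' (t * h))) (at h within UNIV)" for h
  proof (rule leibniz_rule_vector_derivative)
    show "((\<lambda>h. t ^ m *\<^sub>R f (t * h)) has_vector_derivative t ^ Suc m *\<^sub>R f' (t * h)) (at h within UNIV)"
      for h t using der by simp
    show "(\<lambda>t. t ^ m *\<^sub>R f (t * h)) integrable_on cbox 0 1" for h
      by (rule integrable_continuous) (auto intro!: continuous_intros continuous_on_compose2[OF c(1)])
    show "continuous_on (UNIV \<times> cbox 0 1) (\<lambda>(h, t). t ^ Suc m *\<^sub>R f' (t * h))"
      by (auto intro!: continuous_intros continuous_on_compose2[OF c(2)] simp: split_beta)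
  qed auto
  moreover have "Ck k (\<lambda>h. integral {0..1} (\<lambda>t. t ^ Suc m *\<^sub>R f' (t * h)))"
    using Suc.IH * by blast
  ultimately show ?case by (intro Ck_SucI) auto
qed

text \<open>Hadamard's lemma. The quotient is the average of the derivative over the segment from \<open>0\<close> to \<open>h\<close>, that is,
\<open>g(h) = \<integral>\<^sub>0\<^sup>1 f'(t h) dt\<close>, and this formula is smooth at \<open>h = 0\<close> as well.\<close>

lemma smooth_factor:
  fixes f :: "real \<Rightarrow> 'a::euclidean_space"
  assumes "\<And>k. Ck k f" "f 0 = 0"
  obtains g where "\<And>k. Ck k g" "\<And>h. f h = h *\<^sub>R g h"
proof -
  obtain f' where f': "\<And>x. (f has_vector_derivative f' x) (at x)"
    using assms(1)[of "Suc 0"] unfolding Ck.simps(2) by blast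
  have "Ck k f'" for k using assms(1) f' by (rule Ck_derivative)
  define g where "g h = integral {0..1} (\<lambda>t. t ^ 0 *\<^sub>R f' (t * h))" for h
  have "Ck k g" for k
    unfolding g_def using \<open>Ck k f'\<close> by (rule Ck_weighted_average)
  moreover have "f h = h *\<^sub>R g h" for h
  proof -
    have "((\<lambda>t. f (t * h)) has_vector_derivative h *\<^sub>R f' (t * h)) (at t within {0..1})" for t
    proof -
      have "((\<lambda>t. t * h) has_vector_derivative h) (at t)"
        by (auto intro!: derivative_eq_intros)
      from vector_diff_chain_at[OF this f'] show ?thesis
        by (simp add: o_def has_vector_derivative_at_within)
    qed
    then have "((\<lambda>t. h *\<^sub>R f' (t * h)) has_integral f (1 * h) - f (0 * h)) {0..1}"
      by (intro fundamental_theorem_of_calculus) auto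
    then have "integral {0..1} (\<lambda>t. h *\<^sub>R f' (t * h)) = f h"
      using assms(2) by (metis diff_zero integral_unique mult_1 mult_zero_left)
    then show ?thesis by (simp add: g_def)
  qed
  ultimately show ?thesis by (rule that)
qed

section \<open>A bounded smooth function that is the identity near zero\<close>

text \<open>The classical non-analytic function \<open>exp (- 1 / x)\<close>, divided by \<open>x\<^sup>n\<close> so that the family is closed under
differentiation up to linear combinations.\<close>

definition flat :: "nat \<Rightarrow> real \<Rightarrow> real" where
  "flat n x = (if x > 0 then exp (- inverse x) * inverse x ^ n else 0)"

lemma flat_tendsto_0: "(flat n \<longlongrightarrow> 0) (at 0)"
proof -
  have "((\<lambda>y::real. y ^ n / exp y) \<longlongrightarrow> 0) at_top"
    by (rule tendsto_power_div_exp_0)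
  then have "((\<lambda>x::real. inverse x ^ n / exp (inverse x)) \<longlongrightarrow> 0) (at_right 0)"
    by (rule filterlim_compose[OF _ filterlim_inverse_at_top_right])
  then have "(flat n \<longlongrightarrow> 0) (at_right 0)"
    by (rule Lim_transform_eventually)
       (auto simp: eventually_at_filter flat_def exp_minus field_simps)
  moreover have "(flat n \<longlongrightarrow> 0) (at_left 0)"
    by (rule Lim_transform_eventually[OF tendsto_const])
       (auto simp: eventually_at_filter flat_def)
  ultimately show ?thesis
    using filterlim_split_at by blast
qed

lemma flat_has_derivative:
  "(flat n has_real_derivative flat (n + 2) x - n * flat (n + 1) x) (at x)"
proof -
  consider "x > 0" | "x < 0" | "x = 0" by linarith
  then show ?thesis
  proof cases
    case 1
    have "((\<lambda>x. exp (- inverse x) * inverse x ^ n) has_real_derivative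
        flat (n + 2) x - n * flat (n + 1) x) (at x)"
      using 1 by (auto intro!: derivative_eq_intros simp: flat_def power2_eq_square)
        (cases n; simp add: algebra_simps)
    moreover have "\<forall>\<^sub>F y in nhds x. flat n y = exp (- inverse y) * inverse y ^ n"
      using eventually_nhds_in_open[of "{0<..}" x] 1
      by (auto elim!: eventually_mono simp: flat_def)
    ultimately show ?thesis by (subst DERIV_cong_ev[OF refl _ refl])
  next
    case 2
    have "\<forall>\<^sub>F y in nhds x. flat n y = 0"
      using eventually_nhds_in_open[of "{..<0}" x] 2
      by (auto elim!: eventually_mono simp: flat_def)
    then show ?thesis using 2 by (subst DERIV_cong_ev[OF refl _ refl]) (auto simp: flat_def)
  next
    case 3
    have "(flat (Suc n) \<longlongrightarrow> 0) (at 0)" by (rule flat_tendsto_0)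
    then have "((\<lambda>h. (flat n (0 + h) - flat n 0) / h) \<longlongrightarrow> 0) (at 0)"
      by (rule Lim_transform_eventually)
         (auto simp: eventually_at_filter flat_def divide_inverse)
    then show ?thesis using 3 by (simp add: DERIV_def flat_def)
  qed
qed

lemma Ck_flat: "Ck k (flat n)"
proof (induction k arbitrary: n)
  case 0
  then show ?case
    using flat_has_derivative by (auto intro: continuous_at_imp_continuous_on DERIV_isCont)
next
  case (Suc k)
  then show ?case
    by (intro Ck_SucI[where f' = "\<lambda>x. flat (n + 2) x - n * flat (n + 1) x"] Ck_diff Ck_mult Ck_const)
       (use flat_has_derivative in \<open>auto simp flip: has_real_derivative_iff_has_vector_derivative\<close>)
qed

text \<open>The function is \<open>h\<close> times a cutoff that is \<open>1\<close> for \<open>\<bar>h\<bar> \<le> b / 2\<close> and \<open>0\<close> for \<open>\<bar>h\<bar> \<ge> b\<close>. Precomposition with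
it extends to the whole line a construction that works on \<open>[-b, b]\<close> only, without changing it near \<open>0\<close>.\<close>

lemma smooth_truncated_identity:
  fixes b :: real
  assumes "b > 0"
  obtains \<phi> :: "real \<Rightarrow> real" and a where "\<And>k. Ck k \<phi>" "\<And>h. \<bar>\<phi> h\<bar> \<le> b" "a > 0" "\<And>h. \<bar>h\<bar> < a \<Longrightarrow> \<phi> h = h"
proof -
  define a where "a = b / 2"
  define u where "u h = flat 0 (b\<^sup>2 - h\<^sup>2)" for h
  define w where "w h = flat 0 (h\<^sup>2 - a\<^sup>2)" for h
  define \<phi> where "\<phi> h = h * (u h * inverse (u h + w h))" for h
  have ab: "0 < a" "a < b" "a\<^sup>2 < b\<^sup>2"
    using assms by (auto simp: a_def power2_eq_square)
  have uw: "u h \<ge> 0" "w h \<ge> 0" "u h + w h > 0" for h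
    using ab by (auto simp: u_def w_def flat_def add_pos_pos)
  have "Ck k (\<lambda>h. c + d * (h * h))" for k and c d :: real
    by (intro Ck_add Ck_mult Ck_const Ck_ident)
  from Ck_compose[OF Ck_flat this]
  have "Ck k (\<lambda>h. flat 0 (c + d * (h * h)))" for k and c d :: real .
  from this[of _ "b\<^sup>2" "-1"] this[of _ "- a\<^sup>2" "1"]
  have "Ck k u" "Ck k w" for k
    unfolding u_def w_def by (simp_all add: power2_eq_square)
  then have "Ck k \<phi>" for k
    unfolding \<phi>_def using uw(3)
    by (intro Ck_mult Ck_inverse Ck_add Ck_ident) (auto simp: less_le)
  moreover have "\<bar>\<phi> h\<bar> \<le> b" for h
  proof (cases "\<bar>h\<bar> < b")
    case True
    have "\<bar>u h * inverse (u h + w h)\<bar> \<le> 1"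
      using uw[of h] by (simp add: field_simps)
    then have "\<bar>\<phi> h\<bar> \<le> \<bar>h\<bar> * 1"
      unfolding \<phi>_def abs_mult[of h] by (intro mult_left_mono) auto
    with True show ?thesis by simp
  next
    case False
    then have "b\<^sup>2 \<le> h\<^sup>2"
      using assms abs_le_square_iff[of b h] by auto
    then show ?thesis using assms by (simp add: \<phi>_def u_def flat_def)
  qed
  moreover have "\<phi> h = h" if "\<bar>h\<bar> < a" for h
  proof -
    have "h\<^sup>2 < a\<^sup>2" using that ab(1) by (simp add: abs_square_less_1 power2_strict_mono)
    then have "w h = 0" by (simp add: w_def flat_def)
    then show ?thesis using uw(3)[of h] by (simp add: \<phi>_def)
  qed
  ultimately show ?thesis using that ab(1) by blast
qed

section \<open>Diagonal matrices and the matrix exponential\<close>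

definition diag_mat :: "('n \<Rightarrow> 'a::zero) \<Rightarrow> 'a ^ 'n ^ 'n" where
  "diag_mat f = (\<chi> i j. if i = j then f i else 0)"

lemma diag_mat_mult_vec: "diag_mat f *v x = (\<chi> i. f i * x $ i)"
  for f :: "'n::finite \<Rightarrow> 'a::semiring_1"
  by (simp add: vec_eq_iff matrix_vector_mult_def diag_mat_def if_distrib[of "\<lambda>x. x * _"] cong: if_cong)

lemma mult_diag_mat_nth: "(A ** diag_mat f) $ i $ j = A $ i $ j * f j"
  for f :: "'n::finite \<Rightarrow> 'a::semiring_1"
  by (simp add: matrix_matrix_mult_def diag_mat_def if_distrib cong: if_cong)

lemma diag_mat_mult: "diag_mat f ** diag_mat g = diag_mat (\<lambda>i. f i * g i)"
  for f :: "'n::finite \<Rightarrow> 'a::semiring_1"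
  by (simp add: vec_eq_iff mult_diag_mat_nth) (simp add: diag_mat_def)

lemma diag_mat_1: "diag_mat (\<lambda>_. 1) = mat 1"
  by (simp add: diag_mat_def mat_def)

lemma matrix_inv_mult:
  fixes A :: "'a::semiring_1 ^ 'n ^ 'n"
  assumes "invertible A"
  shows "A ** matrix_inv A = mat 1" "matrix_inv A ** A = mat 1"
proof -
  have "A ** matrix_inv A = mat 1 \<and> matrix_inv A ** A = mat 1"
    using assms unfolding invertible_def matrix_inv_def by (rule someI_ex)
  then show "A ** matrix_inv A = mat 1" "matrix_inv A ** A = mat 1" by auto
qed

lemma linear_matrix_mult: "linear (\<lambda>M. P ** M ** Q)"
  for P Q :: "complex ^ 'n ^ 'n"
proof (rule linearI)
  show "P ** (M + M') ** Q = P ** M ** Q + P ** M' ** Q" for M M'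
    by (simp add: vec_eq_iff matrix_matrix_mult_def algebra_simps sum.distrib sum_distrib_left sum_distrib_right)
  show "P ** (c *\<^sub>R M) ** Q = c *\<^sub>R (P ** M ** Q)" for M c
    by (simp add: matrix_scalar_ac flip: scalar_matrix_assoc)
qed

lemma matrix_pow_similar:
  fixes P Q :: "'a::comm_semiring_1 ^ 'n ^ 'n"
  assumes "P ** Q = mat 1" "Q ** P = mat 1"
  shows "matrix_pow (P ** diag_mat f ** Q) k = P ** diag_mat (\<lambda>i. f i ^ k) ** Q"
proof (induction k)
  case 0
  then show ?case by (simp add: diag_mat_1 assms)
next
  case (Suc k)
  have "P ** diag_mat f ** Q ** (P ** diag_mat (\<lambda>i. f i ^ k) ** Q)
      = P ** (diag_mat f ** (Q ** P) ** diag_mat (\<lambda>i. f i ^ k)) ** Q"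
    by (simp add: matrix_mul_assoc)
  with Suc show ?case by (simp add: assms diag_mat_mult)
qed

text \<open>Powers of a diagonalized matrix are taken on the diagonal, and \<open>M \<mapsto> P M Q\<close> is continuous and linear, so the
exponential series is summed on the diagonal too.\<close>

lemma matrix_exp_similar:
  fixes P Q :: "complex ^ 'n ^ 'n"
  assumes "P ** Q = mat 1" "Q ** P = mat 1"
  shows "matrix_exp (P ** diag_mat f ** Q) = P ** diag_mat (\<lambda>i. exp (f i)) ** Q"
proof -
  define L :: "complex ^ 'n \<Rightarrow> complex ^ 'n ^ 'n" where
    "L v = P ** diag_mat (($) v) ** Q" for v
  have nth: "($) (\<chi> i. g i) = g" for g :: "'n \<Rightarrow> complex"
    by (simp add: fun_eq_iff)
  have "linear (\<lambda>v. diag_mat (($) v) :: complex ^ 'n ^ 'n)"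
    by (rule linearI) (simp_all add: diag_mat_def vec_eq_iff)
  from linear_compose[OF this linear_matrix_mult[of P Q]]
  have "linear L"
    by (simp add: L_def[abs_def] o_def)
  then have "bounded_linear L"
    by (simp add: linear_conv_bounded_linear)
  moreover have "(\<lambda>k. \<chi> i. f i ^ k /\<^sub>R fact k) sums (\<chi> i. exp (f i))"
    unfolding sums_def
  proof (rule vec_tendstoI)
    fix i
    show "(\<lambda>n. (\<Sum>k<n. \<chi> i. f i ^ k /\<^sub>R fact k) $ i) \<longlonglongrightarrow> (\<chi> i. exp (f i)) $ i"
      using exp_converges[of "f i"] by (simp add: sums_def)
  qed
  ultimately have "(\<lambda>k. L (\<chi> i. f i ^ k /\<^sub>R fact k)) sums L (\<chi> i. exp (f i))"
    by (rule bounded_linear.sums)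
  moreover have "L (\<chi> i. f i ^ k /\<^sub>R fact k) = matrix_pow (P ** diag_mat f ** Q) k /\<^sub>R fact k" for k
  proof -
    have "L (\<chi> i. f i ^ k /\<^sub>R fact k) = L ((\<chi> i. f i ^ k) /\<^sub>R fact k)"
      by (rule arg_cong[of _ _ L]) (simp add: vec_eq_iff)
    also have "\<dots> = L (\<chi> i. f i ^ k) /\<^sub>R fact k"
      using \<open>bounded_linear L\<close> by (simp add: linear_simps)
    finally show ?thesis
      by (simp add: L_def nth matrix_pow_similar assms)
  qed
  ultimately show ?thesis
    unfolding matrix_exp_def by (simp add: sums_iff L_def nth)
qed

lemma matrix_exp_diag_mat: "matrix_exp (diag_mat f) = diag_mat (\<lambda>i. exp (f i))"
  using matrix_exp_similar[of "mat 1" "mat 1" f] by simp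

section \<open>Simple eigenvalues and diagonalization\<close>

lemma eigenvector_matrix:
  fixes A :: "'a::field ^ 'n ^ 'n" and v :: "'n \<Rightarrow> 'a ^ 'n"
  assumes "\<And>j. A *v v j = f j *s v j"
  shows "A ** (\<chi> i j. v j $ i) = (\<chi> i j. v j $ i) ** diag_mat f"
proof -
  have "(A ** (\<chi> i j. v j $ i)) $ i $ j = (A *v v j) $ i" for i j
    by (simp add: matrix_matrix_mult_def matrix_vector_mult_def)
  then show ?thesis
    by (simp add: vec_eq_iff mult_diag_mat_nth assms)
qed

text \<open>Independence of eigenvectors for distinct eigenvalues. A linear relation \<open>V c = 0\<close> is turned by \<open>A - f j\<close>
into one with coefficients \<open>(f i - f j) c\<^sub>i\<close>, which has smaller support, so induction on the size of the
support applies.\<close>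

lemma invertible_eigenvector_matrix:
  fixes A :: "'a::field ^ 'n ^ 'n" and v :: "'n \<Rightarrow> 'a ^ 'n"
  assumes ev: "\<And>j. A *v v j = f j *s v j" and nz: "\<And>j. v j \<noteq> 0" and "inj f"
  shows "invertible (\<chi> i j. v j $ i)"
proof -
  define V where "V = (\<chi> i j. v j $ i)"
  have V_mult: "(V *v c) = (\<Sum>j\<in>UNIV. c $ j *s v j)" for c
    by (simp add: V_def vec_eq_iff matrix_vector_mult_def mult.commute)
  have AV: "A ** V = V ** diag_mat f"
    unfolding V_def by (rule eigenvector_matrix[OF ev])
  have "c = 0" if "V *v c = 0" for c
    using that
  proof (induction "card {i. c $ i \<noteq> 0}" arbitrary: c rule: less_induct)
    case less
    show ?case
    proof (rule ccontr)
      assume "c \<noteq> 0"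
      then obtain j where j: "c $ j \<noteq> 0" by (auto simp: vec_eq_iff)
      define d where "d = diag_mat f *v c - f j *s c"
      have d_nth: "d $ i = (f i - f j) * c $ i" for i
        by (simp add: d_def diag_mat_mult_vec algebra_simps)
      have "V *v d = A *v (V *v c) - f j *s (V *v c)"
        by (simp add: d_def matrix_vector_mult_diff_distrib matrix_vector_mul_assoc AV
            vector_scalar_commute)
      then have "V *v d = 0" using less.prems by simp
      moreover have "{i. d $ i \<noteq> 0} \<subset> {i. c $ i \<noteq> 0}"
        using j by (auto simp: d_nth)
      then have "card {i. d $ i \<noteq> 0} < card {i. c $ i \<noteq> 0}"
        by (intro psubset_card_mono) auto
      ultimately have "d = 0" using less.hyps by blast
      then have "c $ i = 0" if "i \<noteq> j" for i
        using d_nth[of i] that \<open>inj f\<close> by (auto simp: inj_eq)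
      then have "V *v c = (\<Sum>i\<in>UNIV. if i = j then c $ j *s v j else 0)"
        unfolding V_mult by (intro sum.cong) auto
      then have "c $ j *s v j = 0" using less.prems by simp
      with j nz[of j] show False by simp
    qed
  qed
  then have "\<exists>B. B ** V = mat 1" by (simp add: matrix_left_invertible_ker)
  then show ?thesis unfolding V_def by (simp add: invertible_left_inverse)
qed

lemma eigenvalues_similar:
  fixes A B P :: "'a::field ^ 'n ^ 'n"
  assumes P: "invertible P" and AP: "A ** P = P ** B"
  shows "eigenvalues A = eigenvalues B"
proof (intro equalityI subsetI)
  let ?Q = "matrix_inv P"
  have PQ: "P ** ?Q = mat 1" "?Q ** P = mat 1" using matrix_inv_mult[OF P] by auto
  have inj: "P *v u = P *v w \<longleftrightarrow> u = w" for u w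
    using inj_matrix_vector_mult[OF P] by (auto simp: inj_eq)
  have ev: "A *v (P *v u) = c *s (P *v u) \<longleftrightarrow> B *v u = c *s u" for u c
    using inj[of "B *v u" "c *s u"] by (simp add: matrix_vector_mul_assoc AP vector_scalar_commute)
  show "c \<in> eigenvalues B" if c: "c \<in> eigenvalues A" for c
  proof -
    obtain w where w: "w \<noteq> 0" "A *v w = c *s w" using c by (auto simp: eigenvalues_def)
    have w_eq: "w = P *v (?Q *v w)" by (simp add: matrix_vector_mul_assoc PQ)
    then have "B *v (?Q *v w) = c *s (?Q *v w)" using w(2) ev by metis
    moreover have "?Q *v w \<noteq> 0" using w(1) w_eq by auto
    ultimately show ?thesis by (auto simp: eigenvalues_def)
  qed
  show "c \<in> eigenvalues A" if c: "c \<in> eigenvalues B" for c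
  proof -
    obtain u where u: "u \<noteq> 0" "B *v u = c *s u" using c by (auto simp: eigenvalues_def)
    then have "A *v (P *v u) = c *s (P *v u)" by (simp add: ev)
    moreover have "P *v u \<noteq> 0" using u(1) inj[of u 0] by auto
    ultimately show ?thesis by (auto simp: eigenvalues_def)
  qed
qed

lemma eigenvalues_diag_mat: "eigenvalues (diag_mat f) = range f"
  for f :: "'n::finite \<Rightarrow> 'a::field"
proof (intro equalityI subsetI)
  fix c assume "c \<in> eigenvalues (diag_mat f)"
  then obtain u where u: "u \<noteq> 0" "\<And>i. f i * u $ i = c * u $ i"
    by (auto simp: eigenvalues_def diag_mat_mult_vec vec_eq_iff)
  then obtain i where "u $ i \<noteq> 0" by (auto simp: vec_eq_iff)
  with u(2) show "c \<in> range f" by (metis mult_right_cancel rangeI)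
next
  fix c assume "c \<in> range f"
  then obtain j where "c = f j" by auto
  then have "diag_mat f *v axis j 1 = c *s axis j 1"
    by (auto simp: diag_mat_mult_vec vec_eq_iff axis_def)
  then show "c \<in> eigenvalues (diag_mat f)"
    unfolding eigenvalues_def by (auto intro!: exI[of _ "axis j 1"])
qed

lemma poly_det: "poly (det M) c = det (map_matrix (\<lambda>p. poly p c) M)"
  for M :: "'a::comm_ring_1 poly ^ 'n ^ 'n"
  by (simp add: det_def poly_sum poly_prod)

lemma eigenvalues_eq_roots: "eigenvalues A = {c. poly (charpoly A) c = 0}"
  for A :: "'a::field ^ 'n ^ 'n"
proof -
  have "poly (charpoly A) c = det (mat c - A)" for c
    unfolding charpoly_def poly_det
    by (rule arg_cong[of _ _ det]) (simp add: vec_eq_iff mat_def)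
  moreover have "det (mat c - A) = 0 \<longleftrightarrow> (\<exists>v. v \<noteq> 0 \<and> A *v v = c *s v)" for c
  proof -
    have "mat c *v v = c *s v" for v :: "'a ^ 'n"
      by (simp add: vec_eq_iff matrix_vector_mult_def mat_def if_distrib[of "\<lambda>x. x * _"] cong: if_cong)
    then have *: "(mat c - A) *v v = c *s v - A *v v" for v
      by (simp add: matrix_vector_mult_diff_rdistrib)
    have "det (mat c - A) \<noteq> 0 \<longleftrightarrow> (\<forall>v. (mat c - A) *v v = 0 \<longrightarrow> v = 0)"
      by (simp add: matrix_left_invertible_ker invertible_left_inverse flip: invertible_det_nz)
    then show ?thesis unfolding * by (metis eq_iff_diff_eq_0)
  qed
  ultimately show ?thesis by (simp add: eigenvalues_def)
qed

text \<open>The two statements are proved together, since the bound on the degree is what removes one of the two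
contributions to the leading coefficient in the induction step.\<close>

lemma degree_coeff_prod_linear:
  fixes a b :: "'i \<Rightarrow> 'a::comm_ring_1"
  assumes "finite I"
  shows "degree (\<Prod>i\<in>I. [:a i, b i:]) \<le> card I \<and> coeff (\<Prod>i\<in>I. [:a i, b i:]) (card I) = (\<Prod>i\<in>I. b i)"
  using assms
proof (induction I)
  case (insert x I)
  let ?q = "\<Prod>i\<in>I. [:a i, b i:]"
  have "degree ([:a x, b x:] * ?q) \<le> degree [:a x, b x:] + degree ?q"
    by (rule degree_mult_le)
  also have "\<dots> \<le> Suc (card I)"
    using insert.IH by (simp add: degree_pCons_eq_if)
  finally have "degree ([:a x, b x:] * ?q) \<le> Suc (card I)" .
  moreover have "coeff ?q (Suc (card I)) = 0"
    using insert.IH by (simp add: coeff_eq_0)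
  ultimately show ?case
    using insert by (simp add: mult_pCons_left)
qed simp

text \<open>All entries of \<open>X - A\<close> have degree at most one, so the coefficient of order \<open>n\<close> in the Leibniz expansion is
the Leibniz expansion for the matrix of coefficients of \<open>X\<close>, which is the identity.\<close>

lemma coeff_charpoly_card: "coeff (charpoly A) CARD('n) = 1"
  for A :: "'a::comm_ring_1 ^ 'n ^ 'n"
proof -
  let ?M = "mat [:0, 1:] - map_matrix (\<lambda>a. [:a:]) A"
  have M: "?M $ i $ j = [:- A $ i $ j, (mat 1 :: 'a ^ 'n ^ 'n) $ i $ j:]" for i j
    by (simp add: mat_def)
  have "coeff (\<Prod>i\<in>UNIV. ?M $ i $ q i) CARD('n) = (\<Prod>i\<in>UNIV. (mat 1 :: 'a ^ 'n ^ 'n) $ i $ q i)" for q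
    unfolding M using degree_coeff_prod_linear[of UNIV "\<lambda>i. - A $ i $ q i" "\<lambda>i. (mat 1 :: 'a ^ 'n ^ 'n) $ i $ q i"] by simp
  moreover have "coeff (of_int (sign q) * r) n = of_int (sign q) * coeff r n"
    for q :: "'n \<Rightarrow> 'n" and r :: "'a poly" and n
    by (simp add: of_int_poly)
  ultimately have "coeff (det ?M) CARD('n) = det (mat 1 :: 'a ^ 'n ^ 'n)"
    unfolding det_def coeff_sum by simp
  then show ?thesis by (simp add: charpoly_def)
qed

text \<open>The characteristic polynomial has degree at least \<open>n\<close> and splits into linear factors; if all of these are
distinct, there are at least \<open>n\<close> roots.\<close>

lemma simple_eigenvalues_imp_inj:
  fixes A :: "complex ^ 'n ^ 'n"
  assumes "\<And>c. c \<in> eigenvalues A \<Longrightarrow> simple_eigenvalue A c"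
  obtains f :: "'n \<Rightarrow> complex" where "inj f" "range f \<subseteq> eigenvalues A"
proof -
  let ?p = "charpoly A" and ?R = "eigenvalues A"
  have nz: "?p \<noteq> 0" using coeff_charpoly_card[of A] by auto
  have "finite ?R" unfolding eigenvalues_eq_roots using poly_roots_finite[OF nz] .
  have "?p = smult (lead_coeff ?p) (\<Prod>z\<in>?R. [:-z, 1:] ^ order z ?p)"
    unfolding eigenvalues_eq_roots by (simp add: complex_poly_decompose)
  also have "(\<Prod>z\<in>?R. [:-z, 1:] ^ order z ?p) = (\<Prod>z\<in>?R. [:-z, 1:])"
    using assms by (intro prod.cong) (auto simp: simple_eigenvalue_def)
  finally have "degree ?p \<le> degree (\<Prod>z\<in>?R. [:-z, 1:])"
    by (metis degree_smult_le)
  also have "\<dots> \<le> card ?R"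
    using degree_coeff_prod_linear[OF \<open>finite ?R\<close>, of uminus "\<lambda>_. 1"] by simp
  finally have "CARD('n) \<le> card ?R"
    using le_degree[of ?p "CARD('n)"] coeff_charpoly_card[of A] by simp
  then show thesis
    using card_le_inj[of "UNIV :: 'n set" ?R] \<open>finite ?R\<close> that by auto
qed

lemma diagonalizable_if_simple:
  fixes A :: "complex ^ 'n ^ 'n"
  assumes "\<And>c. c \<in> eigenvalues A \<Longrightarrow> simple_eigenvalue A c"
  obtains f :: "'n \<Rightarrow> complex" and P where "inj f" "range f = eigenvalues A" "invertible P"
    "A = P ** diag_mat f ** matrix_inv P"
proof -
  obtain f :: "'n \<Rightarrow> complex" where f: "inj f" "range f \<subseteq> eigenvalues A"
    using simple_eigenvalues_imp_inj[OF assms] .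
  then have "\<exists>v. v \<noteq> 0 \<and> A *v v = f j *s v" for j by (auto simp: eigenvalues_def)
  then obtain v where v: "\<And>j. v j \<noteq> 0" "\<And>j. A *v v j = f j *s v j" by metis
  define P where "P = (\<chi> i j. v j $ i)"
  have P: "invertible P" "A ** P = P ** diag_mat f"
    unfolding P_def using invertible_eigenvector_matrix[OF v(2,1) f(1)] eigenvector_matrix[OF v(2)] .
  have "A = A ** P ** matrix_inv P"
    using matrix_inv_mult[OF P(1)] by (simp flip: matrix_mul_assoc)
  then show thesis
    using that f(1) eigenvalues_similar[OF P] P by (metis eigenvalues_diag_mat)
qed

section \<open>Matrix norms and perturbation of the determinant\<close>

lemma tendsto_det:
  fixes M :: "'b \<Rightarrow> 'a::real_normed_field ^ 'n ^ 'n"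
  assumes "(M \<longlongrightarrow> M0) F"
  shows "((\<lambda>x. det (M x)) \<longlongrightarrow> det M0) F"
  unfolding det_def by (intro tendsto_intros assms)

lemma norm_le_card_mult:
  fixes x :: "'a::real_normed_vector ^ 'n" and B :: real
  assumes "\<And>i. norm (x $ i) \<le> B"
  shows "norm x \<le> CARD('n) * B"
proof -
  have "norm x \<le> (\<Sum>i\<in>UNIV. norm (x $ i))"
    unfolding norm_vec_def by (rule L2_set_le_sum) auto
  also have "\<dots> \<le> CARD('n) * B"
    using assms by (rule sum_bounded_above)
  finally show ?thesis .
qed

lemma norm_matrix_nth_le: "norm (A $ i $ j) \<le> norm A"
  by (rule order_trans[OF Finite_Cartesian_Product.norm_nth_le Finite_Cartesian_Product.norm_nth_le])

lemma det_nonzero_near: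
  fixes M0 :: "'a::real_normed_field ^ 'n ^ 'n"
  assumes "det M0 \<noteq> 0"
  obtains \<rho> where "\<rho> > 0" "\<And>M. (\<And>i j. norm (M $ i $ j - M0 $ i $ j) \<le> \<rho>) \<Longrightarrow> det M \<noteq> 0"
proof -
  have "(det \<longlongrightarrow> det M0) (nhds M0)"
    by (rule tendsto_det) (rule filterlim_ident)
  then have "\<forall>\<^sub>F M in nhds M0. det M \<noteq> 0"
    using assms by (rule tendsto_imp_eventually_ne)
  then obtain e where e: "e > 0" "\<And>M. dist M M0 < e \<Longrightarrow> det M \<noteq> 0"
    unfolding eventually_nhds_metric by blast
  define N where "N = real CARD('n)"
  have N: "N > 0" by (simp add: N_def)
  define \<rho> where "\<rho> = e / (2 * N * N)"
  have "det M \<noteq> 0" if "\<And>i j. norm (M $ i $ j - M0 $ i $ j) \<le> \<rho>" for M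
  proof (rule e(2))
    have "norm (M - M0) \<le> N * (N * \<rho>)"
      unfolding N_def by (intro norm_le_card_mult) (use that in simp)
    also have "\<dots> < e" using e(1) N by (simp add: \<rho>_def)
    finally show "dist M M0 < e" by (simp add: dist_norm)
  qed
  moreover have "\<rho> > 0" using e(1) N by (simp add: \<rho>_def)
  ultimately show thesis using that by blast
qed

section \<open>Smoothness of eigenpairs along a curve of matrices\<close>

lemma has_vector_derivative_iff_tendsto:
  "(f has_vector_derivative D) (at x) \<longleftrightarrow> ((\<lambda>y. (f y - f x) /\<^sub>R (y - x)) \<longlongrightarrow> D) (at x)"
proof -
  have "(f has_vector_derivative D) (at x) \<longleftrightarrow>
      ((\<lambda>y. norm (f y - f x - (y - x) *\<^sub>R D) / norm (y - x)) \<longlongrightarrow> 0) (at x)"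
    by (simp add: has_vector_derivative_def has_derivative_iff_norm bounded_linear_scaleR_left)
  also have "\<dots> \<longleftrightarrow> ((\<lambda>y. norm ((f y - f x) /\<^sub>R (y - x) - D)) \<longlongrightarrow> 0) (at x)"
  proof (rule tendsto_cong)
    have "norm (f y - f x - (y - x) *\<^sub>R D) / norm (y - x) = norm ((f y - f x) /\<^sub>R (y - x) - D)"
      if "y \<noteq> x" for y
    proof -
      have "(f y - f x) /\<^sub>R (y - x) - D = (f y - f x - (y - x) *\<^sub>R D) /\<^sub>R (y - x)"
        using that by (simp add: scaleR_diff_right)
      then show ?thesis by (simp add: divide_inverse mult.commute)
    qed
    then show "\<forall>\<^sub>F y in at x. norm (f y - f x - (y - x) *\<^sub>R D) / norm (y - x)
        = norm ((f y - f x) /\<^sub>R (y - x) - D)"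
      by (simp add: eventually_at_filter)
  qed
  also have "\<dots> \<longleftrightarrow> ((\<lambda>y. (f y - f x) /\<^sub>R (y - x)) \<longlongrightarrow> D) (at x)"
    by (simp add: tendsto_norm_zero_iff LIM_zero_iff)
  finally show ?thesis .
qed

text \<open>The solution of \<open>M x = b\<close> by Cramer's rule, an expression in the entries of \<open>M\<close> and \<open>b\<close> from which
continuity and smoothness can be read off.\<close>

definition cramer_solution :: "'a::field ^ 'n ^ 'n \<Rightarrow> 'a ^ 'n \<Rightarrow> 'a ^ 'n" where
  "cramer_solution M b = (\<chi> k. det (\<chi> i j. if j = k then b $ i else M $ i $ j) / det M)"

lemma Ck_cramer_solution:
  fixes M :: "real \<Rightarrow> 'a::{real_normed_field, euclidean_space} ^ 'n ^ 'n"
  assumes "\<And>i j. Ck k (\<lambda>x. M x $ i $ j)" "\<And>i. Ck k (\<lambda>x. b x $ i)" "\<And>x. det (M x) \<noteq> 0"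
  shows "Ck k (\<lambda>x. cramer_solution (M x) (b x))"
  unfolding cramer_solution_def divide_inverse
proof (intro Ck_vec_lambda Ck_mult Ck_inverse Ck_det assms)
  show "Ck k (\<lambda>x. (\<chi> i j. if j = m then b x $ i else M x $ i $ j) $ i $ j)" for i j m
    by (cases "j = m") (simp_all add: assms)
qed

lemma tendsto_cramer_solution:
  fixes M :: "'b \<Rightarrow> 'a::real_normed_field ^ 'n ^ 'n"
  assumes "(M \<longlongrightarrow> M0) F" "(b \<longlongrightarrow> b0) F" "det M0 \<noteq> 0"
  shows "((\<lambda>x. cramer_solution (M x) (b x)) \<longlongrightarrow> cramer_solution M0 b0) F"
proof -
  have "((\<lambda>x. \<chi> i j. if j = m then b x $ i else M x $ i $ j) \<longlongrightarrow>
      (\<chi> i j. if j = m then b0 $ i else M0 $ i $ j)) F" for m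
  proof (intro vec_tendstoI)
    show "((\<lambda>x. (\<chi> i j. if j = m then b x $ i else M x $ i $ j) $ i $ j) \<longlongrightarrow>
        (\<chi> i j. if j = m then b0 $ i else M0 $ i $ j) $ i $ j) F" for i j
      using assms by (cases "j = m") (auto intro: tendsto_vec_nth)
  qed
  then show ?thesis
    unfolding cramer_solution_def
    by (intro vec_tendstoI) (auto intro!: tendsto_divide tendsto_det assms)
qed

lemma tendsto_matrix_vector_mult:
  fixes M :: "'b \<Rightarrow> 'a::real_normed_field ^ 'm ^ 'n"
  assumes "(M \<longlongrightarrow> M0) F" "(x \<longlongrightarrow> x0) F"
  shows "((\<lambda>k. M k *v x k) \<longlongrightarrow> M0 *v x0) F"
proof (rule vec_tendstoI)
  show "((\<lambda>k. (M k *v x k) $ i) \<longlongrightarrow> (M0 *v x0) $ i) F" for i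
    unfolding matrix_vector_mult_def vec_lambda_beta
    by (intro tendsto_sum tendsto_mult tendsto_vec_nth assms)
qed

text \<open>An eigenpair is encoded by a single vector \<open>y\<close>: an eigenvector is scaled to have \<open>j\<close>-th entry \<open>1\<close>, and the
place that becomes free in \<open>y\<close> holds the eigenvalue, relative to a reference value \<open>c\<close>. So the eigenvalue is
\<open>c + y $ j\<close>, the eigenvector is \<open>normalized j y\<close>, and there are as many equations as unknowns.\<close>

definition normalized :: "'n \<Rightarrow> complex ^ 'n \<Rightarrow> complex ^ 'n" where
  "normalized j y = (\<chi> i. if i = j then 1 else y $ i)"

text \<open>The derivative of \<open>A v - \<mu> v\<close> with respect to the vector that encodes the pair \<open>(\<mu>, v)\<close>: column \<open>j\<close> belongs
to the eigenvalue, the others to the free entries of the eigenvector.\<close>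

definition eigen_jacobian ::
    "'n \<Rightarrow> complex ^ 'n ^ 'n \<Rightarrow> complex \<Rightarrow> complex ^ 'n \<Rightarrow> complex ^ 'n ^ 'n" where
  "eigen_jacobian j A \<mu> v =
     (\<chi> i m. if m = j then - v $ i else A $ i $ m - (if i = m then \<mu> else 0))"

text \<open>An exact difference formula rather than a linearization: the equation is quadratic, so the Jacobian with the
eigenvalue taken from one eigenpair and the eigenvector from the other accounts for the full difference.\<close>

lemma eigen_jacobian_difference:
  fixes A B :: "complex ^ 'n ^ 'n"
  assumes "A *v normalized j y = (c + y $ j) *s normalized j y"
    and "B *v normalized j z = (c + z $ j) *s normalized j z"
  shows "eigen_jacobian j A (c + y $ j) (normalized j z) *v (z - y) = - ((B - A) *v normalized j z)"
proof -
  let ?v = "normalized j y" and ?w = "normalized j z" and ?\<mu> = "c + y $ j"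
  have "(eigen_jacobian j A ?\<mu> ?w *v (z - y)) $ i
      = (A *v (?w - ?v) - ?\<mu> *s (?w - ?v) - (z $ j - y $ j) *s ?w) $ i" for i
  proof -
    have "(eigen_jacobian j A ?\<mu> ?w *v (z - y)) $ i =
       (\<Sum>m\<in>UNIV. (A $ i $ m * (?w - ?v) $ m - (if m = i then ?\<mu> * (?w - ?v) $ i else 0)
          - (if m = j then (z $ j - y $ j) * ?w $ i else 0)))"
      unfolding matrix_vector_mult_def vec_lambda_beta
      by (rule sum.cong) (auto simp: eigen_jacobian_def normalized_def algebra_simps)
    also have "\<dots> = (A *v (?w - ?v) - ?\<mu> *s (?w - ?v) - (z $ j - y $ j) *s ?w) $ i"
      by (simp add: sum_subtractf matrix_vector_mult_def) (simp add: algebra_simps)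
    finally show ?thesis .
  qed
  then have "eigen_jacobian j A ?\<mu> ?w *v (z - y)
      = A *v (?w - ?v) - ?\<mu> *s (?w - ?v) - (z $ j - y $ j) *s ?w"
    by (simp add: vec_eq_iff)
  also have "\<dots> = A *v ?w - A *v ?v - (c + z $ j) *s ?w + ?\<mu> *s ?v"
    by (simp add: matrix_vector_mult_diff_distrib vec_eq_iff algebra_simps)
  also have "\<dots> = - ((B - A) *v ?w)"
    by (simp add: assms matrix_vector_mult_diff_rdistrib)
  finally show ?thesis .
qed

text \<open>Dividing the difference formula by \<open>k - h\<close> and letting \<open>k \<rightarrow> h\<close> shows that \<open>y\<close> is differentiable, with \<open>y'\<close>
given by Cramer's rule in terms of \<open>A\<close>, \<open>A'\<close> and \<open>y\<close>. Hence if \<open>y\<close> is of class \<open>C\<^sup>k\<close>, so is \<open>y'\<close>, and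
continuity of \<open>y\<close> suffices to start.\<close>

lemma smooth_eigenpair:
  fixes A :: "real \<Rightarrow> complex ^ 'n ^ 'n" and y :: "real \<Rightarrow> complex ^ 'n"
  assumes A: "\<And>k. Ck k A" and y: "continuous_on UNIV y"
    and ev: "\<And>h. A h *v normalized j (y h) = (c + y h $ j) *s normalized j (y h)"
    and J: "\<And>h. det (eigen_jacobian j (A h) (c + y h $ j) (normalized j (y h))) \<noteq> 0"
  shows "Ck k y"
proof -
  let ?J = "\<lambda>h k. eigen_jacobian j (A h) (c + y h $ j) (normalized j (y k))"
  obtain A' where A': "\<And>x. (A has_vector_derivative A' x) (at x)"
    using A[of "Suc 0"] unfolding Ck.simps(2) by blast
  have CA': "Ck k A'" for k using A A' by (rule Ck_derivative)
  define y' where "y' h = cramer_solution (?J h h) (- (A' h *v normalized j (y h)))" for h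
  have der: "(y has_vector_derivative y' h) (at h)" for h
    unfolding has_vector_derivative_iff_tendsto
  proof (rule Lim_transform_eventually)
    have yh: "(y \<longlongrightarrow> y h) (at h)"
      using y continuous_on_eq_continuous_at[OF open_UNIV] isCont_def by blast
    have v: "((\<lambda>k. normalized j (y k)) \<longlongrightarrow> normalized j (y h)) (at h)"
    proof (rule vec_tendstoI)
      show "((\<lambda>k. normalized j (y k) $ i) \<longlongrightarrow> normalized j (y h) $ i) (at h)" for i
        by (cases "i = j") (auto simp: normalized_def intro!: tendsto_vec_nth yh)
    qed
    have Jlim: "((\<lambda>k. ?J h k) \<longlongrightarrow> ?J h h) (at h)"
    proof (intro vec_tendstoI)
      show "((\<lambda>k. ?J h k $ i $ m) \<longlongrightarrow> ?J h h $ i $ m) (at h)" for i m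
        by (cases "m = j") (auto simp: eigen_jacobian_def intro!: tendsto_intros tendsto_vec_nth v)
    qed
    let ?b = "\<lambda>k. - (((A k - A h) /\<^sub>R (k - h)) *v normalized j (y k))"
    have "((\<lambda>k. (A k - A h) /\<^sub>R (k - h)) \<longlongrightarrow> A' h) (at h)"
      using A' unfolding has_vector_derivative_iff_tendsto .
    then have blim: "(?b \<longlongrightarrow> - (A' h *v normalized j (y h))) (at h)"
      by (intro tendsto_minus tendsto_matrix_vector_mult v)
    show "((\<lambda>k. cramer_solution (?J h k) (?b k)) \<longlongrightarrow> y' h) (at h)"
      unfolding y'_def by (intro tendsto_cramer_solution Jlim blim J)
    have "\<forall>\<^sub>F k in at h. det (?J h k) \<noteq> 0"
      using tendsto_det[OF Jlim] J by (rule tendsto_imp_eventually_ne)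
    then show "\<forall>\<^sub>F k in at h. cramer_solution (?J h k) (?b k) = (y k - y h) /\<^sub>R (k - h)"
    proof eventually_elim
      case (elim k)
      have lin: "linear (\<lambda>x. ?J h k *v x)" by (rule matrix_vector_mul_linear)
      have "?J h k *v ((y k - y h) /\<^sub>R (k - h)) = (?J h k *v (y k - y h)) /\<^sub>R (k - h)"
        using linear_scale[OF lin] .
      also have "\<dots> = (- ((A k - A h) *v normalized j (y k))) /\<^sub>R (k - h)"
        using eigen_jacobian_difference[OF ev ev, of h k] by simp
      also have "\<dots> = ?b k"
        by (simp add: vec_eq_iff matrix_vector_mult_def sum_distrib_left sum_distrib_right scaleR_sum_right)
      finally show ?case
        unfolding cramer[OF elim] cramer_solution_def by simp
    qed
  qed
  show ?thesis
  proof (induction k)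
    case 0
    show ?case using y by simp
  next
    case (Suc k)
    have v: "Ck k (\<lambda>h. normalized j (y h) $ i)" for i
      using Ck_vec_nth[OF Suc, of i] Ck_const by (cases "i = j") (auto simp: normalized_def)
    have "Ck k (\<lambda>h. ?J h h $ i $ m)" for i m
    proof (cases "m = j")
      case True
      then show ?thesis using Ck_minus[OF v] by (simp add: eigen_jacobian_def)
    next
      case False
      have "Ck k (\<lambda>h. A h $ i $ m - (if i = m then c + y h $ j else 0))"
        by (cases "i = m") (auto intro!: Ck_diff Ck_add Ck_const Ck_vec_nth A Suc)
      then show ?thesis using False by (simp add: eigen_jacobian_def)
    qed
    moreover have "Ck k (\<lambda>h. (- (A' h *v normalized j (y h))) $ i)" for i
      unfolding matrix_vector_mult_def
      by (auto intro!: Ck_minus Ck_sum Ck_mult Ck_vec_nth CA' v)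
    ultimately have "Ck k y'"
      unfolding y'_def[abs_def] by (rule Ck_cramer_solution) (rule J)
    with der show ?case by (rule Ck_SucI)
  qed
qed

section \<open>Eigenpairs of almost diagonal matrices\<close>

text \<open>With \<open>A = \<Lambda> + E\<close> and \<open>v = normalized j y\<close>, row \<open>j\<close> of the eigenvalue equation reads \<open>y\<^sub>j = (E v)\<^sub>j\<close>, and row
\<open>i \<noteq> j\<close> reads \<open>(\<lambda>\<^sub>i - \<lambda>\<^sub>j) y\<^sub>i = y\<^sub>j y\<^sub>i - (E v)\<^sub>i\<close>. Solved for the left-hand sides these are fixed point
equations whose right-hand sides are small of first order in \<open>E\<close> or quadratic in \<open>y\<close>.\<close>

definition eigen_iteration ::
    "'n::finite \<Rightarrow> ('n \<Rightarrow> complex) \<Rightarrow> complex ^ 'n ^ 'n \<Rightarrow> complex ^ 'n \<Rightarrow> complex ^ 'n" where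
  "eigen_iteration j lam A y = (\<chi> i.
     let e = ((A - diag_mat lam) *v normalized j y) $ i
     in if i = j then e else (y $ j * y $ i - e) / (lam i - lam j))"

lemma eigen_iteration_fixed_point:
  assumes "inj lam" "eigen_iteration j lam A y = y"
  shows "A *v normalized j y = (lam j + y $ j) *s normalized j y"
proof -
  let ?v = "normalized j y"
  have E: "((A - diag_mat lam) *v ?v) $ i = (A *v ?v) $ i - lam i * ?v $ i" for i
    by (simp add: matrix_vector_mult_diff_rdistrib diag_mat_mult_vec)
  have fp: "y $ i = (if i = j then (A *v ?v) $ i - lam i * ?v $ i
     else (y $ j * y $ i - ((A *v ?v) $ i - lam i * ?v $ i)) / (lam i - lam j))" for i
    using arg_cong[OF assms(2), of "\<lambda>x. x $ i"]
    by (simp add: eigen_iteration_def Let_def E split: if_splits)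
  have "(A *v ?v) $ i = (lam j + y $ j) * ?v $ i" for i
  proof (cases "i = j")
    case True
    have "?v $ j = 1" by (simp add: normalized_def)
    then show ?thesis using fp[of j] True by (simp add: algebra_simps)
  next
    case False
    then have "lam i - lam j \<noteq> 0" using assms(1) by (simp add: inj_eq)
    moreover have "y $ i = (y $ j * y $ i - ((A *v ?v) $ i - lam i * ?v $ i)) / (lam i - lam j)"
      using fp[of i] False by simp
    ultimately have "y $ i * (lam i - lam j) = y $ j * y $ i - ((A *v ?v) $ i - lam i * ?v $ i)"
      by (metis nonzero_eq_divide_eq)
    moreover have "?v $ i = y $ i" using False by (simp add: normalized_def)
    ultimately show ?thesis by (simp add: algebra_simps)
  qed
  then show ?thesis by (simp add: vec_eq_iff distrib_right)
qed

lemma eigen_iteration_diag: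
  "eigen_iteration j lam (diag_mat b) (axis j (b j - lam j)) = axis j (b j - lam j)"
proof -
  have "((diag_mat b - diag_mat lam) *v normalized j (axis j (b j - lam j))) $ i
      = (if i = j then b j - lam j else 0)" for i
    by (simp add: matrix_vector_mult_diff_rdistrib diag_mat_mult_vec normalized_def axis_def)
  then show ?thesis
    by (simp add: eigen_iteration_def vec_eq_iff axis_def Let_def)
qed

lemma norm_matrix_vector_nth_le:
  fixes M :: "complex ^ 'n ^ 'm"
  shows "norm ((M *v x) $ i) \<le> CARD('n) * norm M * norm x"
proof -
  have "norm ((M *v x) $ i) \<le> (\<Sum>k\<in>UNIV. norm (M $ i $ k) * norm (x $ k))"
    unfolding matrix_vector_mult_def vec_lambda_beta
    by (rule order_trans[OF norm_sum]) (simp add: norm_mult)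
  also have "\<dots> \<le> (\<Sum>k\<in>(UNIV :: 'n set). norm M * norm x)"
    by (intro sum_mono mult_mono norm_matrix_nth_le Finite_Cartesian_Product.norm_nth_le) auto
  finally show ?thesis by simp
qed

lemma norm_normalized_diff_le: "norm (normalized j y - normalized j z) \<le> norm (y - z)"
  by (rule norm_le_componentwise_cart) (simp add: normalized_def)

lemma norm_axis: "norm (axis j x :: 'a::real_normed_vector ^ 'n) = norm x"
proof -
  have "(\<Sum>i\<in>UNIV. (norm ((axis j x :: 'a ^ 'n) $ i))\<^sup>2) = (\<Sum>i\<in>UNIV. if i = j then (norm x)\<^sup>2 else 0)"
    by (intro sum.cong) (auto simp: axis_def)
  then show ?thesis by (simp add: norm_vec_def L2_set_def)
qed

lemma norm_normalized_le: "norm (normalized j y) \<le> 1 + norm y"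
proof -
  have "normalized j 0 = axis j 1" by (simp add: normalized_def axis_def vec_eq_iff)
  then have "norm (normalized j y) \<le> norm (axis j (1 :: complex)) + norm (normalized j y - normalized j 0)"
    by (metis norm_triangle_sub)
  also have "\<dots> \<le> 1 + norm (y - 0)"
    by (intro add_mono norm_normalized_diff_le) (simp add: norm_axis)
  finally show ?thesis by simp
qed

text \<open>This single estimate, in which both the matrix and the vector vary, serves for the contraction property, the
invariance of a small ball, and the Lipschitz dependence of the fixed point on the matrix.\<close>

lemma eigen_iteration_diff_le:
  fixes lam :: "'n::finite \<Rightarrow> complex" and K N :: real
  defines "N \<equiv> real CARD('n)"
  assumes K: "K \<ge> 1" "\<And>i. norm (inverse (lam i - lam j)) \<le> K"
    and A: "norm (A - diag_mat lam) \<le> \<epsilon>"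
    and y: "norm y \<le> r" "norm z \<le> r" and r: "r \<le> 1"
  shows "norm (eigen_iteration j lam A y - eigen_iteration j lam B z)
    \<le> N * K * ((2 * r + N * \<epsilon>) * norm (y - z) + 2 * N * norm (A - B))"
  unfolding mult.assoc[of N] unfolding N_def
proof (rule norm_le_card_mult, fold N_def)
  fix i
  let ?E = "A - diag_mat lam" and ?F = "B - diag_mat lam"
  let ?v = "normalized j y" and ?w = "normalized j z"
  let ?e = "(?E *v ?v) $ i - (?F *v ?w) $ i"
  have N: "N \<ge> 0" by (simp add: N_def)
  have r0: "r \<ge> 0" by (rule order_trans[OF norm_ge_zero y(1)])
  have "?e = (?E *v (?v - ?w)) $ i + ((A - B) *v ?w) $ i"
    by (simp add: matrix_vector_mult_diff_distrib matrix_vector_mult_diff_rdistrib)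
  then have "norm ?e \<le> N * norm ?E * norm (?v - ?w) + N * norm (A - B) * norm ?w"
    unfolding N_def by (auto intro: norm_triangle_mono norm_matrix_vector_nth_le)
  also have "\<dots> \<le> N * \<epsilon> * norm (y - z) + N * norm (A - B) * 2"
    using N A norm_normalized_diff_le[of j y z] norm_normalized_le[of j z] y r
      order_trans[OF norm_ge_zero A]
    by (intro add_mono mult_mono) auto
  finally have e: "norm ?e \<le> N * \<epsilon> * norm (y - z) + 2 * N * norm (A - B)" by simp
  have "y $ j * y $ i - z $ j * z $ i = y $ j * (y - z) $ i + (y - z) $ j * z $ i"
    by (simp add: algebra_simps)
  then have "norm (y $ j * y $ i - z $ j * z $ i)
      \<le> norm (y $ j) * norm ((y - z) $ i) + norm ((y - z) $ j) * norm (z $ i)"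
    by (metis norm_mult norm_triangle_ineq)
  also have "\<dots> \<le> r * norm (y - z) + norm (y - z) * r"
    using order_trans[OF Finite_Cartesian_Product.norm_nth_le y(1)]
      order_trans[OF Finite_Cartesian_Product.norm_nth_le y(2)] r0
    by (intro add_mono mult_mono Finite_Cartesian_Product.norm_nth_le) auto
  finally have q: "norm (y $ j * y $ i - z $ j * z $ i) \<le> 2 * r * norm (y - z)" by simp
  define R where "R = (2 * r + N * \<epsilon>) * norm (y - z) + 2 * N * norm (A - B)"
  have eR: "norm ?e \<le> R"
  proof -
    have "0 \<le> 2 * r * norm (y - z)" using r0 by simp
    with e show ?thesis unfolding R_def distrib_right by linarith
  qed
  have qeR: "norm ((y $ j * y $ i - z $ j * z $ i) - ?e) \<le> R"
    using norm_triangle_ineq4[of "y $ j * y $ i - z $ j * z $ i" ?e] q e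
    unfolding R_def distrib_right by linarith
  have "norm ((eigen_iteration j lam A y - eigen_iteration j lam B z) $ i) \<le> K * R"
  proof (cases "i = j")
    case True
    then have "norm ((eigen_iteration j lam A y - eigen_iteration j lam B z) $ i) \<le> 1 * R"
      using eR by (simp add: eigen_iteration_def Let_def)
    also have "\<dots> \<le> K * R"
      using K(1) order_trans[OF norm_ge_zero eR] by (rule mult_right_mono)
    finally show ?thesis .
  next
    case False
    then have "(eigen_iteration j lam A y - eigen_iteration j lam B z) $ i
        = inverse (lam i - lam j) * ((y $ j * y $ i - z $ j * z $ i) - ?e)"
      by (simp add: eigen_iteration_def Let_def divide_inverse algebra_simps)
    then show ?thesis
      unfolding norm_mult using K qeR by (auto simp: norm_mult intro!: mult_mono)
  qed
  then show "norm ((eigen_iteration j lam A y - eigen_iteration j lam B z) $ i)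
      \<le> K * ((2 * r + N * \<epsilon>) * norm (y - z) + 2 * N * norm (A - B))"
    by (simp add: R_def)
qed

text \<open>A contraction with factor \<open>1 / 2\<close> on a ball of radius \<open>r\<close>. The Lipschitz bound in the matrix gives both the
continuity needed for smoothness and, by comparison with diagonal matrices, the order of approximation.\<close>

lemma eigenpair_branch:
  fixes lam :: "'n::finite \<Rightarrow> complex"
  assumes "inj lam" "r0 > 0"
  obtains \<epsilon> C and X :: "complex ^ 'n ^ 'n \<Rightarrow> complex ^ 'n" where
    "\<epsilon> > 0" "\<epsilon> \<le> r0" "C \<ge> 0"
    "\<And>A. norm (A - diag_mat lam) \<le> \<epsilon> \<Longrightarrow> norm (X A) \<le> r0"
    "\<And>A. norm (A - diag_mat lam) \<le> \<epsilon> \<Longrightarrow>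
       A *v normalized j (X A) = (lam j + X A $ j) *s normalized j (X A)"
    "\<And>A B. norm (A - diag_mat lam) \<le> \<epsilon> \<Longrightarrow> norm (B - diag_mat lam) \<le> \<epsilon> \<Longrightarrow>
       norm (X A - X B) \<le> C * norm (A - B)"
    "\<And>b. norm (diag_mat b - diag_mat lam) \<le> \<epsilon> \<Longrightarrow> X (diag_mat b) = axis j (b j - lam j)"
proof -
  define N where "N = real CARD('n)"
  \<comment> \<open>The summand for \<open>i = j\<close> is \<open>0\<close>, as \<open>inverse 0 = 0\<close>.\<close>
  define K where "K = 1 + (\<Sum>i\<in>UNIV. norm (inverse (lam i - lam j)))"
  \<comment> \<open>The choices of \<open>r\<close> and \<open>\<epsilon>\<close> bound each of the contributions \<open>N K \<cdot> 2 r\<close> and \<open>N K \<cdot> N \<epsilon>\<close> to the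
     Lipschitz constant by \<open>1 / 4\<close>; the latter equals \<open>r / 4\<close>, which also keeps the ball invariant.\<close>
  define r where "r = min (min r0 1) (1 / (8 * N * K))"
  define \<epsilon> where "\<epsilon> = r / (4 * N * N * K)"
  let ?T = "eigen_iteration j lam" and ?\<Lambda> = "diag_mat lam"
  have K: "K \<ge> 1" "\<And>i. norm (inverse (lam i - lam j)) \<le> K"
    using member_le_sum[of _ UNIV "\<lambda>i. norm (inverse (lam i - lam j))"]
    by (auto simp: K_def intro!: sum_nonneg add_increasing)
  have N: "N \<ge> 1" by (simp add: N_def Suc_leI)
  have NK: "N * N * K \<ge> 1" using N K(1) by (simp add: mult_ge1_I)
  have r: "r > 0" "r \<le> 1" "r \<le> r0"
    using N K(1) assms(2) by (auto simp: r_def)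
  have "r * (8 * N * K) \<le> 1"
    using N K(1) by (simp add: r_def pos_le_divide_eq[symmetric])
  then have c1: "N * K * (2 * r) \<le> 1 / 4" by (simp add: algebra_simps)
  have c2: "N * K * (N * \<epsilon>) = r / 4" "\<epsilon> > 0"
    using N K(1) r by (auto simp: \<epsilon>_def)
  have "\<epsilon> \<le> r" using NK r by (simp add: \<epsilon>_def divide_le_eq_1 pos_divide_le_eq mult.assoc)
  have step: "norm (?T A y - ?T B z) \<le> 1 / 2 * norm (y - z) + 2 * N * N * K * norm (A - B)"
    if "norm (A - ?\<Lambda>) \<le> \<epsilon>" "norm y \<le> r" "norm z \<le> r" for A B y z
  proof -
    have "norm (?T A y - ?T B z) \<le> N * K * ((2 * r + N * \<epsilon>) * norm (y - z) + 2 * N * norm (A - B))"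
      unfolding N_def using eigen_iteration_diff_le[OF K that r(2)] .
    also have "\<dots> = (N * K * (2 * r) + N * K * (N * \<epsilon>)) * norm (y - z) + 2 * N * N * K * norm (A - B)"
      by (simp add: algebra_simps)
    also have "\<dots> \<le> 1 / 2 * norm (y - z) + 2 * N * N * K * norm (A - B)"
      using c1 c2 r by (intro add_right_mono mult_right_mono) auto
    finally show ?thesis .
  qed
  have T0: "?T ?\<Lambda> 0 = 0"
    using eigen_iteration_diag[of j lam lam] by (metis axis_eq_0_iff diff_self)
  have fixp: "\<exists>!y\<in>cball 0 r. ?T A y = y" if A: "norm (A - ?\<Lambda>) \<le> \<epsilon>" for A
  proof (rule Banach_fix[where c = "1 / 2"])
    show "?T A ` cball 0 r \<subseteq> cball 0 r"
    proof clarify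
      fix y :: "complex ^ 'n" assume "y \<in> cball 0 r"
      then have y: "norm y \<le> r" by simp
      have "norm (?T A y) \<le> 1 / 2 * norm y + 2 * N * N * K * norm (A - ?\<Lambda>)"
        using step[OF A y, of 0 ?\<Lambda>] r(1) by (simp add: T0)
      also have "\<dots> \<le> 1 / 2 * r + 2 * N * N * K * \<epsilon>"
        using y A N K(1) by (intro add_mono mult_left_mono) auto
      also have "\<dots> = r" using c2(1) by (simp add: algebra_simps)
      finally show "?T A y \<in> cball 0 r" by simp
    qed
    show "dist (?T A y) (?T A z) \<le> 1 / 2 * dist y z" if "y \<in> cball 0 r" "z \<in> cball 0 r" for y z
      using step[OF A, of y z A] that by (simp add: dist_norm)
  qed (use r in \<open>auto simp: complete_eq_closed\<close>)
  define X where "X A = (THE y. y \<in> cball 0 r \<and> ?T A y = y)" for A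
  have X: "norm (X A) \<le> r" "?T A (X A) = X A" if "norm (A - ?\<Lambda>) \<le> \<epsilon>" for A
    using theI'[OF fixp[OF that]] by (auto simp: X_def)
  have X_eq: "X A = y" if "norm (A - ?\<Lambda>) \<le> \<epsilon>" "norm y \<le> r" "?T A y = y" for A y
    using fixp[OF that(1)] X[OF that(1)] that(2,3) by auto
  show thesis
  proof (rule that[of \<epsilon> "4 * N * N * K" X])
    show "\<epsilon> > 0" "\<epsilon> \<le> r0" "4 * N * N * K \<ge> 0"
      using c2 \<open>\<epsilon> \<le> r\<close> r N K(1) by auto
  next
    fix A assume A: "norm (A - ?\<Lambda>) \<le> \<epsilon>"
    show "norm (X A) \<le> r0" using X(1)[OF A] r by simp
    show "A *v normalized j (X A) = (lam j + X A $ j) *s normalized j (X A)"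
      using assms(1) X(2)[OF A] by (rule eigen_iteration_fixed_point)
    fix B assume B: "norm (B - ?\<Lambda>) \<le> \<epsilon>"
    show "norm (X A - X B) \<le> 4 * N * N * K * norm (A - B)"
      using step[OF A X(1)[OF A] X(1)[OF B], of B] by (simp add: X(2) A B)
  next
    fix b assume b: "norm (diag_mat b - ?\<Lambda>) \<le> \<epsilon>"
    have "norm (axis j (b j - lam j)) = norm ((diag_mat b - ?\<Lambda>) $ j $ j)"
      by (simp add: norm_axis diag_mat_def)
    also have "\<dots> \<le> r"
      using norm_matrix_nth_le[of "diag_mat b - ?\<Lambda>" j j] b \<open>\<epsilon> \<le> r\<close> by linarith
    finally show "X (diag_mat b) = axis j (b j - lam j)"
      using X_eq[OF b] eigen_iteration_diag by blast
  qed
qed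

text \<open>All that later sections need about the encoded eigenpair \<open>X A\<close> near \<open>(\<lambda>\<^sub>j, e\<^sub>j)\<close>, for matrices \<open>A\<close> within
\<open>\<epsilon>\<close> of the diagonal matrix. For a diagonal matrix the eigenvector is exactly \<open>e\<^sub>j\<close>, so that only the entry
for the eigenvalue is present.\<close>

definition eigen_branch ::
    "('n::finite \<Rightarrow> complex) \<Rightarrow> 'n \<Rightarrow> real \<Rightarrow> real \<Rightarrow> real \<Rightarrow>
      (complex ^ 'n ^ 'n \<Rightarrow> complex ^ 'n) \<Rightarrow> bool" where
  "eigen_branch lam j r \<epsilon> C X \<longleftrightarrow>
    (\<forall>A. norm (A - diag_mat lam) \<le> \<epsilon> \<longrightarrow> norm (X A) \<le> r \<and>
       A *v normalized j (X A) = (lam j + X A $ j) *s normalized j (X A)) \<and>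
    (\<forall>A B. norm (A - diag_mat lam) \<le> \<epsilon> \<longrightarrow> norm (B - diag_mat lam) \<le> \<epsilon> \<longrightarrow>
       norm (X A - X B) \<le> C * norm (A - B)) \<and>
    (\<forall>b. norm (diag_mat b - diag_mat lam) \<le> \<epsilon> \<longrightarrow> X (diag_mat b) = axis j (b j - lam j)) \<and>
    (\<forall>A. (\<forall>k. Ck k A) \<longrightarrow> (\<forall>h. norm (A h - diag_mat lam) \<le> \<epsilon>) \<longrightarrow> (\<forall>k. Ck k (\<lambda>h. X (A h))))"

lemma eigen_branch_mono:
  assumes "eigen_branch lam j r \<epsilon>' C' X" "\<epsilon> \<le> \<epsilon>'" "C' \<le> C"
  shows "eigen_branch lam j r \<epsilon> C X"
proof -
  have small: "norm M \<le> \<epsilon>'" if "norm M \<le> \<epsilon>" for M :: "complex ^ 'a ^ 'a"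
    using that assms(2) by simp
  have "norm (X A - X B) \<le> C * norm (A - B)" if "norm (X A - X B) \<le> C' * norm (A - B)" for A B
    using that mult_right_mono[OF assms(3), of "norm (A - B)"] by simp
  with small assms(1) show ?thesis unfolding eigen_branch_def by simp
qed

text \<open>At the unperturbed eigenpair the Jacobian is diagonal with entries \<open>-1\<close> and \<open>\<lambda>\<^sub>i - \<lambda>\<^sub>j\<close>, hence invertible, and
it stays invertible in a neighbourhood. Continuity along a curve comes from the Lipschitz bound.\<close>

lemma smooth_eigenpair_branch:
  fixes lam :: "'n::finite \<Rightarrow> complex"
  assumes "inj lam" "r0 > 0"
  obtains \<epsilon> C X where "\<epsilon> > 0" "C \<ge> 0" "eigen_branch lam j r0 \<epsilon> C X"
proof -
  define J0 where "J0 = diag_mat (\<lambda>i. if i = j then -1 else lam i - lam j)"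
  have "det J0 = (\<Prod>i\<in>UNIV. if i = j then -1 else lam i - lam j)"
    unfolding J0_def by (subst det_diagonal) (auto simp: diag_mat_def)
  also have "\<dots> \<noteq> 0" using assms(1) by (auto simp: inj_eq)
  finally obtain \<rho> where \<rho>: "\<rho> > 0"
    "\<And>M. (\<And>i m. norm (M $ i $ m - J0 $ i $ m) \<le> \<rho>) \<Longrightarrow> det M \<noteq> 0"
    using det_nonzero_near by blast
  define r where "r = min r0 (\<rho> / 2)"
  have r: "r > 0" "r \<le> r0" "2 * r \<le> \<rho>" using \<rho> assms(2) by (auto simp: r_def)
  obtain \<epsilon> C and X :: "complex ^ 'n ^ 'n \<Rightarrow> complex ^ 'n" where
    \<epsilon>: "\<epsilon> > 0" "\<epsilon> \<le> r" and C: "C \<ge> 0"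
    and X_small: "\<And>A. norm (A - diag_mat lam) \<le> \<epsilon> \<Longrightarrow> norm (X A) \<le> r"
    and X_ev: "\<And>A. norm (A - diag_mat lam) \<le> \<epsilon> \<Longrightarrow>
       A *v normalized j (X A) = (lam j + X A $ j) *s normalized j (X A)"
    and X_lip: "\<And>A B. norm (A - diag_mat lam) \<le> \<epsilon> \<Longrightarrow> norm (B - diag_mat lam) \<le> \<epsilon> \<Longrightarrow>
       norm (X A - X B) \<le> C * norm (A - B)"
    and X_diag: "\<And>b. norm (diag_mat b - diag_mat lam) \<le> \<epsilon> \<Longrightarrow> X (diag_mat b) = axis j (b j - lam j)"
    using eigenpair_branch[OF assms(1) r(1), of j] by blast
  have det: "det (eigen_jacobian j A (lam j + X A $ j) (normalized j (X A))) \<noteq> 0"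
    if A: "norm (A - diag_mat lam) \<le> \<epsilon>" for A
  proof (rule \<rho>(2))
    fix i m
    have a: "norm (A $ i $ m - diag_mat lam $ i $ m) \<le> r"
      using norm_matrix_nth_le[of "A - diag_mat lam" i m] A \<epsilon>(2) by simp
    have x: "norm (X A $ n) \<le> r" for n
      by (rule order_trans[OF Finite_Cartesian_Product.norm_nth_le X_small[OF A]])
    show "norm (eigen_jacobian j A (lam j + X A $ j) (normalized j (X A)) $ i $ m - J0 $ i $ m) \<le> \<rho>"
    proof (cases "m = j")
      case True
      then show ?thesis
        using x[of i] r by (auto simp: eigen_jacobian_def normalized_def J0_def diag_mat_def)
    next
      case False
      then have "eigen_jacobian j A (lam j + X A $ j) (normalized j (X A)) $ i $ m - J0 $ i $ m
          = (A $ i $ m - diag_mat lam $ i $ m) - (if i = m then X A $ j else 0)"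
        by (auto simp: eigen_jacobian_def J0_def diag_mat_def)
      also have "norm \<dots> \<le> r + r"
        using x[of j] r(1) by (intro norm_triangle_le_diff add_mono a) auto
      finally show ?thesis using r(3) by simp
    qed
  qed
  have smooth: "Ck k (\<lambda>h. X (A h))"
    if A: "\<And>k. Ck k A" and small: "\<And>h. norm (A h - diag_mat lam) \<le> \<epsilon>" for A k
  proof (rule smooth_eigenpair[OF A _ X_ev[OF small] det[OF small]])
    have contA: "(A \<longlongrightarrow> A h) (at h)" for h
      using Ck_imp_continuous[OF A[of 0]] continuous_on_eq_continuous_at[OF open_UNIV] isCont_def by blast
    have "((\<lambda>k. X (A k)) \<longlongrightarrow> X (A h)) (at h)" for h
    proof (rule Lim_null[THEN iffD2], rule Lim_null_comparison)
      show "\<forall>\<^sub>F k in at h. norm (X (A k) - X (A h)) \<le> C * norm (A k - A h)"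
        using X_lip small by (intro always_eventually allI) blast
      show "((\<lambda>k. C * norm (A k - A h)) \<longlongrightarrow> 0) (at h)"
        using contA[of h] by (intro tendsto_mult_right_zero tendsto_norm_zero) (simp add: LIM_zero_iff)
    qed
    then show "continuous_on UNIV (\<lambda>h. X (A h))"
      by (auto simp: continuous_on_def)
  qed
  have "eigen_branch lam j r0 \<epsilon> C X"
    unfolding eigen_branch_def
    using X_small r(2) X_ev X_lip X_diag smooth by (auto intro: order_trans)
  with \<epsilon>(1) C show thesis by (rule that)
qed

lemma eigenpair_branches:
  fixes lam :: "'n::finite \<Rightarrow> complex"
  assumes "inj lam" "r0 > 0"
  obtains \<epsilon> C X where "\<epsilon> > 0" "C \<ge> 0" "\<And>j. eigen_branch lam j r0 \<epsilon> C (X j)"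
proof -
  have "\<exists>\<epsilon> C X. \<epsilon> > 0 \<and> C \<ge> 0 \<and> eigen_branch lam j r0 \<epsilon> C X" for j
    using smooth_eigenpair_branch[OF assms, of j] by metis
  then obtain e c X where Q: "\<And>j. e j > 0 \<and> c j \<ge> 0 \<and> eigen_branch lam j r0 (e j) (c j) (X j)"
    by metis
  define \<epsilon> where "\<epsilon> = Min (range e)"
  define C where "C = Max (range c)"
  have "\<epsilon> \<in> range e" unfolding \<epsilon>_def by (rule Min_in) auto
  then have "\<epsilon> > 0" using Q by auto
  have "C \<in> range c" unfolding C_def by (rule Max_in) auto
  then have "C \<ge> 0" using Q by auto
  have "eigen_branch lam j r0 \<epsilon> C (X j)" for j
    by (rule eigen_branch_mono[of lam j r0 "e j" "c j"]) (use Q in \<open>auto simp: \<epsilon>_def C_def\<close>)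
  with \<open>\<epsilon> > 0\<close> \<open>C \<ge> 0\<close> show thesis by (rule that)
qed

section \<open>Eigenvalues on the unit circle and their arguments\<close>

text \<open>If \<open>s\<^sub>k\<close> is the reflection of \<open>s\<^sub>j\<close> in the unit circle, then \<open>s\<^sub>k cnj s\<^sub>j = 1\<close> reads
\<open>\<mu>\<^sub>k - cnj \<mu>\<^sub>j = i t \<mu>\<^sub>k cnj \<mu>\<^sub>j\<close>. So \<open>\<mu>\<^sub>k\<close> is close to \<open>cnj \<mu>\<^sub>j\<close>, which is close to the real number \<open>l\<^sub>j\<close>,
and the gap between the \<open>l\<^sub>i\<close> leaves only \<open>k = j\<close>.\<close>

lemma unimodular_if_reciprocal_symmetric:
  fixes \<mu> :: "'n \<Rightarrow> complex" and l :: "'n \<Rightarrow> real" and t :: real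
  assumes gap: "\<And>i j. i \<noteq> j \<Longrightarrow> g \<le> \<bar>l i - l j\<bar>"
    and close: "\<And>j. norm (\<mu> j - l j) \<le> r" and bound: "\<And>j. norm (\<mu> j) \<le> M"
    and small: "2 * r + \<bar>t\<bar> * M\<^sup>2 < g" "\<bar>t\<bar> * M < 1"
    and symm: "range (\<lambda>j. 1 + \<i> * t * \<mu> j) = cnj ` inverse ` range (\<lambda>j. 1 + \<i> * t * \<mu> j)"
  shows "norm (1 + \<i> * t * \<mu> j) = 1"
proof (cases "t = 0")
  case False
  define s where "s j = 1 + \<i> * t * \<mu> j" for j
  have s_nz: "s j \<noteq> 0" for j
  proof
    assume "s j = 0"
    then have "norm (\<i> * t * \<mu> j) = 1"
      unfolding s_def by (metis add_eq_0_iff norm_minus_cancel norm_one)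
    moreover have "norm (\<i> * t * \<mu> j) \<le> \<bar>t\<bar> * M"
      using bound[of j] by (simp add: norm_mult mult_left_mono)
    ultimately show False using small(2) by simp
  qed
  have "cnj (inverse (s j)) \<in> range s" using symm unfolding s_def[abs_def] by blast
  then obtain k where k: "cnj (inverse (s j)) = s k" by auto
  then have prod: "s k * cnj (s j) = 1" using s_nz[of j] by (simp flip: k)
  then have "\<i> * t * (\<mu> k - cnj (\<mu> j) - \<i> * t * \<mu> k * cnj (\<mu> j)) = 0"
    by (simp add: s_def algebra_simps)
  then have "\<mu> k - cnj (\<mu> j) = \<i> * t * \<mu> k * cnj (\<mu> j)"
    using False by simp
  then have "norm (\<mu> k - cnj (\<mu> j)) = \<bar>t\<bar> * (norm (\<mu> k) * norm (\<mu> j))"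
    by (simp add: norm_mult)
  also have "\<dots> \<le> \<bar>t\<bar> * (M * M)"
    using order_trans[OF norm_ge_zero bound[of j]] by (intro mult_left_mono mult_mono bound) auto
  finally have *: "norm (\<mu> k - cnj (\<mu> j)) \<le> \<bar>t\<bar> * M\<^sup>2" by (simp add: power2_eq_square)
  have cl: "norm (cnj (\<mu> j) - l j) \<le> r"
    using close[of j] by (metis complex_cnj_complex_of_real complex_cnj_diff complex_mod_cnj)
  have "k = j"
  proof (rule ccontr)
    assume "k \<noteq> j"
    then have "g \<le> \<bar>l k - l j\<bar>" by (rule gap)
    also have "\<dots> = norm (complex_of_real (l k) - l j)"
      by (metis norm_of_real of_real_diff real_norm_def)
    also have "\<dots> = norm ((\<mu> k - cnj (\<mu> j)) - (\<mu> k - l k) + (cnj (\<mu> j) - l j))"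
      by (rule arg_cong[of _ _ norm]) simp
    also have "\<dots> \<le> norm (\<mu> k - cnj (\<mu> j)) + norm (\<mu> k - l k) + norm (cnj (\<mu> j) - l j)"
      by (intro norm_triangle_le add_right_mono norm_triangle_ineq4)
    also have "\<dots> \<le> \<bar>t\<bar> * M\<^sup>2 + r + r" by (intro add_mono * close cl)
    finally show False using small(1) by simp
  qed
  with prod have "(norm (s j))\<^sup>2 = 1"
    by (metis complex_norm_square of_real_eq_1_iff)
  then have "norm (s j) = 1" by (metis norm_ge_zero one_power2 power2_eq_imp_eq zero_le_one)
  then show ?thesis by (simp add: s_def)
qed simp

lemma norm_Ln_diff_le:
  assumes "norm (z - 1) \<le> 1 / 2" "norm (w - 1) \<le> 1 / 2"
  shows "norm (Ln z - Ln w) \<le> 2 * norm (z - w)"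
proof (rule field_differentiable_bound[of "cball 1 (1 / 2)" Ln inverse 2])
  fix x :: complex assume "x \<in> cball 1 (1 / 2)"
  then have x: "norm (x - 1) \<le> 1 / 2" by (simp add: dist_norm norm_minus_commute)
  then have "\<bar>Re x - 1\<bar> \<le> 1 / 2"
    using abs_Re_le_cmod[of "x - 1"] by simp
  then have "x \<notin> \<real>\<^sub>\<le>\<^sub>0" by (auto simp: complex_nonpos_Reals_iff)
  then show "(Ln has_field_derivative inverse x) (at x within cball 1 (1 / 2))"
    by (rule has_field_derivative_at_within[OF has_field_derivative_Ln])
  have "1 / 2 \<le> norm x" using x norm_triangle_ineq2[of 1 "1 - x"] by (simp add: norm_minus_commute)
  then show "norm (inverse x) \<le> 2"
    using le_imp_inverse_le[of "1 / 2" "norm x"] by (simp add: norm_inverse)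
qed (use assms in \<open>auto simp: dist_norm norm_minus_commute\<close>)

lemma tendsto_exp_difference_quotient:
  "((\<lambda>h. (exp (\<i> * of_real h * c) - 1) / (\<i> * of_real h)) \<longlongrightarrow> c) (at 0)"
proof -
  have "((\<lambda>h. exp (\<i> * of_real h * c)) has_vector_derivative \<i> * c) (at 0)"
    by (rule has_vector_derivative_eq_rhs[OF has_vector_derivative_real_field])
       (auto intro!: derivative_eq_intros)
  then have "((\<lambda>h. (exp (\<i> * of_real h * c) - 1) /\<^sub>R h) \<longlongrightarrow> \<i> * c) (at 0)"
    unfolding has_vector_derivative_iff_tendsto by simp
  then have "((\<lambda>h. ((exp (\<i> * of_real h * c) - 1) /\<^sub>R h) / \<i>) \<longlongrightarrow> (\<i> * c) / \<i>) (at 0)"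
    by (intro tendsto_divide tendsto_const) auto
  moreover have "((exp (\<i> * of_real h * c) - 1) /\<^sub>R h) / \<i> = (exp (\<i> * of_real h * c) - 1) / (\<i> * of_real h)" for h
    by (simp add: scaleR_conv_of_real divide_inverse ac_simps)
  ultimately show ?thesis by simp
qed


section \<open>Families with diagonal leading part\<close>

lemma norm_map_matrix_mult: "norm (map_matrix ((*) c) M) = norm c * norm M"
  for M :: "complex ^ 'n ^ 'm"
  by (simp add: norm_vec_def norm_mult L2_set_right_distrib)

lemma tendsto_abs_power_zero: "p \<ge> 1 \<Longrightarrow> ((\<lambda>h::real. C * \<bar>h\<bar> ^ p) \<longlongrightarrow> 0) (at 0)"
  by (rule tendsto_eq_intros refl tendsto_ident_at | simp)+

text \<open>The eigenvalue of \<open>(exp (i h H) - 1) / (i h)\<close> that belongs to the eigenvalue \<open>x\<close> of \<open>H\<close>. At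
\<open>h = 0\<close> its value is \<open>0\<close>, because division by zero gives zero, but its limit is \<open>x\<close>.\<close>

definition exp_quotient :: "real \<Rightarrow> real \<Rightarrow> complex" where
  "exp_quotient h x = (exp (\<i> * of_real h * of_real x) - 1) / (\<i> * of_real h)"

text \<open>Passing from \<open>T h\<close> to \<open>(T h - 1) / (i h)\<close> separates the eigenvalues at \<open>h = 0\<close>, at the price of one order in
the error bound; \<open>p \<ge> 1\<close> ensures that the remaining error still tends to \<open>0\<close>, which determines \<open>A 0\<close>.\<close>

lemma first_order_quotient:
  fixes T :: "real \<Rightarrow> complex ^ 'n ^ 'n" and l :: "'n \<Rightarrow> real"
  assumes T: "\<And>k. Ck k T" and p: "p \<ge> 1"
    and near: "\<forall>\<^sub>F h in at 0.
      norm (T h - diag_mat (\<lambda>j. exp (\<i> * of_real h * of_real (l j)))) \<le> C * \<bar>h\<bar> ^ (p + 1)"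
  obtains A where "\<And>k. Ck k A" "\<And>h. T h = mat 1 + map_matrix ((*) (\<i> * of_real h)) (A h)"
    "A 0 = diag_mat (\<lambda>j. of_real (l j))"
    "((\<lambda>h. diag_mat (\<lambda>j. exp_quotient h (l j))) \<longlongrightarrow> diag_mat (\<lambda>j. of_real (l j))) (at 0)"
    "\<forall>\<^sub>F h in at 0. norm (A h - diag_mat (\<lambda>j. exp_quotient h (l j))) \<le> C * \<bar>h\<bar> ^ p"
proof -
  let ?E = "\<lambda>h. diag_mat (\<lambda>j. exp (\<i> * of_real h * of_real (l j))) :: complex ^ 'n ^ 'n"
  let ?B = "\<lambda>h. diag_mat (\<lambda>j. exp_quotient h (l j)) :: complex ^ 'n ^ 'n"
  let ?\<Lambda> = "diag_mat (\<lambda>j. of_real (l j)) :: complex ^ 'n ^ 'n"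
  have contE: "(?E \<longlongrightarrow> ?E 0) (at 0)"
  proof (intro vec_tendstoI)
    show "((\<lambda>h. ?E h $ i $ j) \<longlongrightarrow> ?E 0 $ i $ j) (at 0)" for i j
      by (cases "i = j") (auto simp: diag_mat_def intro!: tendsto_eq_intros)
  qed
  have cont: "(f \<longlongrightarrow> f x) (at x)" if "Ck 0 f" for f :: "real \<Rightarrow> complex ^ 'n ^ 'n" and x
    using that by (simp add: continuous_on_def)
  have "((\<lambda>h. T h - ?E h) \<longlongrightarrow> 0) (at 0)"
    by (rule Lim_null_comparison[OF near tendsto_abs_power_zero]) simp
  from tendsto_add[OF this contE] have "(T \<longlongrightarrow> ?E 0) (at 0)" by simp
  with cont[OF T] have "T 0 = ?E 0"
    by (rule tendsto_unique[OF trivial_limit_at])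
  then have T0: "T 0 = mat 1" by (simp add: diag_mat_1)
  have "Ck k (\<lambda>h. T h - mat 1)" for k by (intro Ck_diff T Ck_const)
  then obtain G where G: "\<And>k. Ck k G" "\<And>h. T h - mat 1 = h *\<^sub>R G h"
    using smooth_factor[of "\<lambda>h. T h - mat 1"] T0 by auto
  define A where "A h = (\<chi> i j. - \<i> * G h $ i $ j)" for h
  have A: "Ck k A" for k
    unfolding A_def by (intro Ck_vec_lambda Ck_mult Ck_const Ck_vec_nth G(1))
  have T_eq: "T h = mat 1 + map_matrix ((*) (\<i> * of_real h)) (A h)" for h
  proof -
    have "T h = mat 1 + h *\<^sub>R G h" using G(2)[of h] by (simp add: algebra_simps)
    moreover have "\<i> * of_real h * (- \<i> * z) = h *\<^sub>R z" for z
      by (simp add: complex_eq_iff)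
    ultimately show ?thesis by (simp add: A_def vec_eq_iff del: mult_minus_left)
  qed
  have diff: "A h - ?B h = map_matrix ((*) (1 / (\<i> * of_real h))) (T h - ?E h)" if "h \<noteq> 0" for h
  proof -
    have "(A h - ?B h) $ i $ j = 1 / (\<i> * of_real h) * (T h - ?E h) $ i $ j" for i j
    proof -
      have *: "A h $ i $ j = 1 / (\<i> * of_real h) * (T h $ i $ j - mat 1 $ i $ j)"
        using that by (simp add: T_eq)
      show ?thesis unfolding vector_minus_component *
        by (simp add: diag_mat_def mat_def exp_quotient_def diff_divide_distrib)
    qed
    then show ?thesis by (simp add: vec_eq_iff)
  qed
  have close: "\<forall>\<^sub>F h in at 0. norm (A h - ?B h) \<le> C * \<bar>h\<bar> ^ p"
    using near eventually_neq_at_within[of 0 0 UNIV]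
  proof eventually_elim
    case (elim h)
    have "norm (A h - ?B h) = norm (T h - ?E h) / \<bar>h\<bar>"
      using elim by (simp add: diff norm_map_matrix_mult norm_divide norm_mult)
    also have "\<dots> \<le> C * \<bar>h\<bar> ^ (p + 1) / \<bar>h\<bar>"
      using elim by (intro divide_right_mono) auto
    finally show ?case using elim by simp
  qed
  have limB: "(?B \<longlongrightarrow> ?\<Lambda>) (at 0)"
  proof (intro vec_tendstoI)
    show "((\<lambda>h. ?B h $ i $ j) \<longlongrightarrow> ?\<Lambda> $ i $ j) (at 0)" for i j
      using tendsto_exp_difference_quotient[of "of_real (l i)"]
      by (cases "i = j") (auto simp: diag_mat_def exp_quotient_def)
  qed
  have "((\<lambda>h. A h - ?B h) \<longlongrightarrow> 0) (at 0)"
    by (rule Lim_null_comparison[OF close tendsto_abs_power_zero[OF p]])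
  from tendsto_add[OF this limB] have "(A \<longlongrightarrow> ?\<Lambda>) (at 0)" by simp
  with cont[OF A] have "A 0 = ?\<Lambda>"
    by (rule tendsto_unique[OF trivial_limit_at])
  then show thesis using A T_eq limB close by (rule_tac that)
qed

text \<open>The theorem in coordinates in which \<open>H\<close> is diagonal. Both estimates come from comparing the eigenpairs of
\<open>(T h - 1) / (i h)\<close> with those of the diagonal matrix of the numbers \<open>exp_quotient h (l j)\<close>, which has the
eigenvectors that \<open>V\<close> has at \<open>h = 0\<close>.\<close>

lemma diagonal_leading_part:
  fixes T :: "real \<Rightarrow> complex ^ 'n ^ 'n" and l :: "'n \<Rightarrow> real"
  assumes T: "\<And>k. Ck k T" and p: "p \<ge> 1" and l: "inj l"
    and near: "\<forall>\<^sub>F h in at 0.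
      norm (T h - diag_mat (\<lambda>j. exp (\<i> * of_real h * of_real (l j)))) \<le> C * \<bar>h\<bar> ^ (p + 1)"
    and symm: "\<And>h. eigenvalues (T h) = cnj ` inverse ` eigenvalues (T h)"
  obtains d :: "'n \<Rightarrow> real \<Rightarrow> real" and V :: "real \<Rightarrow> complex ^ 'n ^ 'n" and a K where "\<And>j k. Ck k (d j)" "\<And>k. Ck k V" "\<And>h. invertible (V h)" "a > 0"
    "\<And>h. \<bar>h\<bar> < a \<Longrightarrow> T h ** V h = V h ** diag_mat (\<lambda>j. exp (\<i> * of_real h * of_real (d j h)))"
    "\<forall>\<^sub>F h in at 0. norm (V h - V 0) \<le> K * \<bar>h\<bar> ^ p"
    "\<And>j. \<forall>\<^sub>F h in at 0. \<bar>d j h - d j 0\<bar> \<le> K * \<bar>h\<bar> ^ p"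
proof -
  define lam where "lam = (\<lambda>j. complex_of_real (l j))"
  let ?\<Lambda> = "diag_mat lam"
  let ?B = "\<lambda>h. diag_mat (\<lambda>j. exp_quotient h (l j)) :: complex ^ 'n ^ 'n"
  have lam: "inj lam" using l by (auto simp: lam_def inj_on_def)
  obtain A where A: "\<And>k. Ck k A"
    and TA: "\<And>h. T h = mat 1 + map_matrix ((*) (\<i> * of_real h)) (A h)"
    and A0: "A 0 = ?\<Lambda>" and limB: "(?B \<longlongrightarrow> ?\<Lambda>) (at 0)"
    and AB: "\<forall>\<^sub>F h in at 0. norm (A h - ?B h) \<le> C * \<bar>h\<bar> ^ p"
    using first_order_quotient[OF T p near] unfolding lam_def by blast
  obtain \<rho> where \<rho>: "\<rho> > 0"
    "\<And>M :: complex ^ 'n ^ 'n. (\<And>i j. norm (M $ i $ j - mat 1 $ i $ j) \<le> \<rho>) \<Longrightarrow> det M \<noteq> 0"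
    using det_nonzero_near[of "mat 1 :: complex ^ 'n ^ 'n"] by auto
  obtain g where g: "g > 0" "\<And>i j. i \<noteq> j \<Longrightarrow> g \<le> \<bar>l i - l j\<bar>"
  proof -
    \<comment> \<open>The element \<open>1\<close> keeps the set nonempty when there is only one index.\<close>
    let ?G = "insert 1 ((\<lambda>(i, j). \<bar>l i - l j\<bar>) ` {(i, j). i \<noteq> j})"
    have "Min ?G \<in> ?G" by (rule Min_in) auto
    then have "Min ?G > 0" using l by (auto simp: inj_eq)
    moreover have "Min ?G \<le> \<bar>l i - l j\<bar>" if "i \<noteq> j" for i j
      by (rule Min_le) (use that in auto)
    ultimately show thesis by (rule that)
  qed
  \<comment> \<open>Within \<open>r\<close> of the unperturbed eigenpairs, the matrix of eigenvectors is invertible (by \<open>\<rho>\<close>) and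
     eigenvalues cannot be confused (by \<open>g / 4\<close>).\<close>
  define r where "r = min 1 (min \<rho> (g / 4))"
  have r: "r > 0" "r \<le> 1" "r \<le> \<rho>" "r \<le> g / 4" using \<rho> g by (auto simp: r_def)
  obtain \<epsilon> C' X where \<epsilon>: "\<epsilon> > 0" and C': "C' \<ge> 0" and X: "\<And>j. eigen_branch lam j r \<epsilon> C' (X j)"
    using eigenpair_branches[OF lam r(1)] by blast
  note X = X[unfolded eigen_branch_def]
  define M where "M = 1 + (\<Sum>j\<in>UNIV. \<bar>l j\<bar>)"
  have M: "M \<ge> 1" "\<And>j. 1 + \<bar>l j\<bar> \<le> M"
    using member_le_sum[of _ UNIV "\<lambda>j. \<bar>l j\<bar>"] by (auto simp: M_def intro!: sum_nonneg)
  obtain c0 where c0: "c0 > 0" "\<And>h. \<bar>h\<bar> < c0 \<Longrightarrow> norm (A h - ?\<Lambda>) \<le> \<epsilon>"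
  proof -
    have "continuous (at 0) A"
      using A[of 0] by (simp add: continuous_on_eq_continuous_at)
    then obtain s where "s > 0" "\<And>h. dist h 0 < s \<Longrightarrow> dist (A h) (A 0) < \<epsilon>"
      using \<epsilon> unfolding continuous_at_eps_delta by blast
    then show thesis by (intro that[of s]) (auto simp: A0 dist_norm intro: less_imp_le)
  qed
  \<comment> \<open>The last two bounds keep \<open>s j h\<close> within \<open>1 / 2\<close> of \<open>1\<close>, away from the branch cut of \<open>Ln\<close>, and make the
     reflected eigenvalue close enough to be identified.\<close>
  define c where "c = min (c0 / 2) (min (1 / (2 * M)) (g / (4 * M\<^sup>2)))"
  have c: "c > 0" "c < c0" "c * M \<le> 1 / 2" "c * M\<^sup>2 \<le> g / 4"
  proof -
    show "c > 0" using c0 M g by (auto simp: c_def)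
    show "c < c0" using c0 by (auto simp: c_def)
    have "c \<le> 1 / (2 * M)" "c \<le> g / (4 * M\<^sup>2)" by (auto simp: c_def)
    then show "c * M \<le> 1 / 2" "c * M\<^sup>2 \<le> g / 4"
      using M(1) by (auto simp: field_simps)
  qed
  obtain \<phi> :: "real \<Rightarrow> real" and a where
    \<phi>: "\<And>k. Ck k \<phi>" "\<And>h. \<bar>\<phi> h\<bar> \<le> c" "a > 0" "\<And>h. \<bar>h\<bar> < a \<Longrightarrow> \<phi> h = h"
    using smooth_truncated_identity[OF c(1)] by blast
  \<comment> \<open>From here on everything is defined on the whole line, and agrees with the intended objects where
     \<open>\<phi> h = h\<close>.\<close>
  define F where "F h = A (\<phi> h)" for h
  have F: "\<And>k. Ck k F" "\<And>h. norm (F h - ?\<Lambda>) \<le> \<epsilon>"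
    unfolding F_def using Ck_compose[OF A \<phi>(1)] c0(2) order_le_less_trans[OF \<phi>(2) c(2)] by auto
  define v where "v j h = normalized j (X j (F h))" for j h
  define \<mu> where "\<mu> j h = lam j + X j (F h) $ j" for j h
  define s where "s j h = 1 + \<i> * \<phi> h * \<mu> j h" for j h
  define V where "V h = (\<chi> i j. v j h $ i)" for h
  have XF: "Ck k (\<lambda>h. X j (F h))" for j k using X F by blast
  have X_small: "norm (X j (F h) $ i) \<le> r" for j h i
    by (rule order_trans[OF Finite_Cartesian_Product.norm_nth_le]) (use X F(2) in blast)
  have Cv: "Ck k (\<lambda>h. v j h $ i)" for k i j
    using Ck_vec_nth[OF XF] by (cases "i = j") (auto simp: v_def normalized_def Ck_const)
  have CV: "Ck k V" for k
    unfolding V_def by (intro Ck_vec_lambda Cv)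
  have Cmu: "Ck k (\<mu> j)" for k j
    unfolding \<mu>_def[abs_def] by (intro Ck_add Ck_const Ck_vec_nth XF)
  have C_of_real: "Ck k (\<lambda>h. complex_of_real (\<phi> h))" for k
    by (rule Ck_bounded_linear[OF bounded_linear_of_real \<phi>(1)])
  have Cs: "Ck k (s j)" for k j
    unfolding s_def[abs_def] by (intro Ck_add Ck_const Ck_mult Cmu C_of_real)
  have V_inv: "invertible (V h)" for h
    unfolding invertible_det_nz
  proof (rule \<rho>(2))
    show "norm (V h $ i $ j - mat 1 $ i $ j) \<le> \<rho>" for i j
      using X_small[of j h i] r(1,3) by (simp add: V_def v_def normalized_def mat_def)
  qed
  have FV: "F h ** V h = V h ** diag_mat (\<lambda>j. \<mu> j h)" for h
    unfolding V_def
  proof (rule eigenvector_matrix)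
    show "F h *v v j h = \<mu> j h *s v j h" for j
      unfolding v_def \<mu>_def using X F(2) by blast
  qed
  have TV: "T (\<phi> h) ** V h = V h ** diag_mat (\<lambda>j. s j h)" for h
  proof -
    have "(T (\<phi> h) ** V h) $ i $ j = (V h ** diag_mat (\<lambda>j. s j h)) $ i $ j" for i j
    proof -
      have "(T (\<phi> h) ** V h) = V h + map_matrix ((*) (\<i> * \<phi> h)) (F h ** V h)"
        unfolding TA F_def
        by (simp add: vec_eq_iff matrix_matrix_mult_def mat_def distrib_right sum.distrib
            sum_distrib_left mult.assoc if_distrib[of "\<lambda>x. x * _"] cong: if_cong)
      then show ?thesis
        by (simp add: FV mult_diag_mat_nth s_def algebra_simps)
    qed
    then show ?thesis by (simp add: vec_eq_iff)
  qed
  have mu_bound: "norm (\<mu> j h) \<le> M" and mu_close: "norm (\<mu> j h - l j) \<le> r" for j h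
  proof -
    show "norm (\<mu> j h - l j) \<le> r" using X_small by (simp add: \<mu>_def lam_def)
    have "norm (\<mu> j h) \<le> \<bar>l j\<bar> + r"
      unfolding \<mu>_def using X_small[of j h j] by (intro norm_triangle_le add_mono) (simp_all add: lam_def)
    then show "norm (\<mu> j h) \<le> M" using M(2)[of j] r(2) by simp
  qed
  have s_unit: "norm (s j h) = 1" for j h
    unfolding s_def
  proof (rule unimodular_if_reciprocal_symmetric[where l = l and r = r and M = M and g = g])
    have "\<bar>\<phi> h\<bar> * M\<^sup>2 \<le> c * M\<^sup>2" "\<bar>\<phi> h\<bar> * M \<le> c * M"
      using \<phi>(2) M(1) by (auto intro!: mult_right_mono)
    then show "2 * r + \<bar>\<phi> h\<bar> * M\<^sup>2 < g" "\<bar>\<phi> h\<bar> * M < 1"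
      using c r(4) g(1) by linarith+
    have "eigenvalues (T (\<phi> h)) = range (\<lambda>j. s j h)"
      using eigenvalues_similar[OF V_inv TV] by (simp add: eigenvalues_diag_mat)
    with symm[of "\<phi> h"]
    show "range (\<lambda>j. 1 + \<i> * \<phi> h * \<mu> j h) = cnj ` inverse ` range (\<lambda>j. 1 + \<i> * \<phi> h * \<mu> j h)"
      by (simp add: s_def)
  qed (use mu_bound mu_close g(2) in auto)
  have s_near: "norm (s j h - 1) \<le> 1 / 2" for j h
  proof -
    have "norm (s j h - 1) = \<bar>\<phi> h\<bar> * norm (\<mu> j h)" by (simp add: s_def norm_mult)
    also have "\<dots> \<le> c * M" using \<phi>(2) mu_bound c(1) by (intro mult_mono) auto
    finally show ?thesis using c(3) by simp
  qed
  have s_slit: "s j h \<notin> \<real>\<^sub>\<le>\<^sub>0" for j h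
  proof -
    have "\<bar>Re (s j h) - 1\<bar> \<le> 1 / 2"
      using abs_Re_le_cmod[of "s j h - 1"] s_near[of j h] by simp
    then show ?thesis by (auto simp: complex_nonpos_Reals_iff)
  qed
  define \<theta> where "\<theta> j h = Im (Ln (s j h))" for j h
  have C\<theta>: "Ck k (\<theta> j)" for k j
    unfolding \<theta>_def[abs_def] by (intro Ck_bounded_linear[OF bounded_linear_Im] Ck_Ln Cs s_slit)
  have Ln_s: "Ln (s j h) = \<i> * \<theta> j h" for j h
  proof -
    have "s j h \<noteq> 0" using s_unit[of j h] by auto
    then have "Re (Ln (s j h)) = 0" using s_unit[of j h] by (simp add: Re_Ln)
    then show ?thesis by (simp add: complex_eq_iff \<theta>_def)
  qed
  have exp_\<theta>: "exp (\<i> * \<theta> j h) = s j h" for j h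
  proof -
    have "s j h \<noteq> 0" using s_unit[of j h] by auto
    then show ?thesis by (simp flip: Ln_s)
  qed
  have "\<phi> 0 = 0" using \<phi>(3,4) by simp
  have "\<theta> j 0 = 0" for j by (simp add: \<theta>_def s_def \<open>\<phi> 0 = 0\<close>)
  then have "\<exists>d. (\<forall>k. Ck k d) \<and> (\<forall>h. \<theta> j h = h *\<^sub>R d h)" for j
    using smooth_factor[OF C\<theta>, of j] by metis
  then obtain d where d: "\<And>j k. Ck k (d j)" "\<And>j h. \<theta> j h = h * d j h"
    by (metis real_scaleR_def)
  have main: "T h ** V h = V h ** diag_mat (\<lambda>j. exp (\<i> * of_real h * of_real (d j h)))" if "\<bar>h\<bar> < a" for h
    using TV[of h] by (simp add: \<phi>(4)[OF that] exp_\<theta>[symmetric] d(2) mult.assoc)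
  have ev_a: "\<forall>\<^sub>F h in at 0. \<bar>h\<bar> < a"
    using \<phi>(3) by (auto simp: eventually_at dist_norm intro!: exI[of _ a])
  have ev_B: "\<forall>\<^sub>F h in at 0. norm (?B h - ?\<Lambda>) \<le> \<epsilon>"
    using tendstoD[OF limB \<epsilon>] by (auto simp: dist_norm elim: eventually_mono)
  define K where "K = C' * C"
  have est: "\<forall>\<^sub>F h in at 0. \<forall>j. norm (X j (F h) - axis j (exp_quotient h (l j) - lam j)) \<le> K * \<bar>h\<bar> ^ p"
    using AB ev_a ev_B
  proof eventually_elim
    case (elim h)
    show ?case
    proof
      fix j
      have "X j (?B h) = axis j (exp_quotient h (l j) - lam j)"
        using X elim(3) by blast
      then have "norm (X j (F h) - axis j (exp_quotient h (l j) - lam j)) \<le> C' * norm (F h - ?B h)"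
        using X F(2) elim(3) by metis
      also have "\<dots> \<le> C' * (C * \<bar>h\<bar> ^ p)"
        using C' elim by (intro mult_left_mono) (auto simp: F_def \<phi>(4))
      finally show "norm (X j (F h) - axis j (exp_quotient h (l j) - lam j)) \<le> K * \<bar>h\<bar> ^ p"
        by (simp add: K_def)
    qed
  qed
  have V0: "V 0 = mat 1"
  proof -
    have F0: "F 0 = ?\<Lambda>" by (simp add: F_def \<open>\<phi> 0 = 0\<close> A0)
    have "X j (F 0) = axis j (lam j - lam j)" for j
      using X F(2)[of 0] unfolding F0 by blast
    then have "X j (F 0) $ i = 0" if "i \<noteq> j" for i j
      using that by (simp add: axis_def)
    then show ?thesis by (auto simp: V_def v_def normalized_def mat_def vec_eq_iff)
  qed
  have estV: "\<forall>\<^sub>F h in at 0. norm (V h - V 0) \<le> CARD('n) * (CARD('n) * K) * \<bar>h\<bar> ^ p"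
    using est
  proof eventually_elim
    case (elim h)
    have "norm ((V h - V 0) $ i $ j) \<le> K * \<bar>h\<bar> ^ p" for i j
    proof -
      have "(V h - V 0) $ i $ j = (if i = j then 0 else (X j (F h) - axis j (exp_quotient h (l j) - lam j)) $ i)"
        unfolding V0 by (simp add: V_def v_def normalized_def mat_def axis_def)
      then have "norm ((V h - V 0) $ i $ j) \<le> norm (X j (F h) - axis j (exp_quotient h (l j) - lam j))"
        using Finite_Cartesian_Product.norm_nth_le[of "X j (F h) - axis j (exp_quotient h (l j) - lam j)" i]
        by simp
      also have "\<dots> \<le> K * \<bar>h\<bar> ^ p" using elim by blast
      finally show ?thesis .
    qed
    then have "norm (V h - V 0) \<le> CARD('n) * (CARD('n) * (K * \<bar>h\<bar> ^ p))"
      by (intro norm_le_card_mult)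
    then show ?case by (simp add: mult.assoc)
  qed
  have estd: "\<forall>\<^sub>F h in at 0. \<bar>d j h - l j\<bar> \<le> 2 * K * \<bar>h\<bar> ^ p" for j
  proof -
    have "((\<lambda>h. exp (\<i> * of_real h * of_real (l j))) \<longlongrightarrow> 1) (at 0)"
      by (auto intro!: tendsto_eq_intros)
    then have "\<forall>\<^sub>F h in at 0. dist (exp (\<i> * of_real h * of_real (l j))) 1 < 1 / 2"
      by (rule tendstoD) simp
    moreover have "((\<lambda>h. \<bar>h * l j\<bar>) \<longlongrightarrow> 0) (at 0)"
      by (auto intro!: tendsto_eq_intros)
    then have "\<forall>\<^sub>F h in at 0. \<bar>h * l j\<bar> < pi"
      by (rule order_tendstoD) simp
    ultimately show ?thesis
      using est ev_a eventually_neq_at_within[of 0 0 UNIV]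
    proof eventually_elim
      case (elim h)
      let ?e = "exp (\<i> * of_real h * of_real (l j))"
      have mu_eq: "\<mu> j h - exp_quotient h (l j) = (X j (F h) - axis j (exp_quotient h (l j) - lam j)) $ j"
        by (simp add: \<mu>_def axis_def)
      have mu: "norm (\<mu> j h - exp_quotient h (l j)) \<le> K * \<bar>h\<bar> ^ p"
        unfolding mu_eq
        by (rule order_trans[OF Finite_Cartesian_Product.norm_nth_le elim(3)[rule_format]])
      have "s j h - ?e = \<i> * h * (\<mu> j h - exp_quotient h (l j))"
        using elim by (simp add: s_def \<phi>(4) exp_quotient_def field_simps)
      then have "norm (s j h - ?e) = \<bar>h\<bar> * norm (\<mu> j h - exp_quotient h (l j))"
        by (simp add: norm_mult)
      also have "\<dots> \<le> \<bar>h\<bar> * (K * \<bar>h\<bar> ^ p)" using mu by (intro mult_left_mono) auto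
      finally have se: "norm (s j h - ?e) \<le> \<bar>h\<bar> * (K * \<bar>h\<bar> ^ p)" .
      have Lne: "Ln ?e = \<i> * (h * l j)"
        using elim(2) by (subst Ln_exp) auto
      have "\<bar>h\<bar> * \<bar>d j h - l j\<bar> = norm (\<i> * of_real (\<theta> j h - h * l j))"
        unfolding norm_mult norm_of_real d(2) right_diff_distrib[symmetric] by (simp add: abs_mult)
      also have "\<dots> = norm (Ln (s j h) - Ln ?e)"
        unfolding Lne Ln_s by (simp add: right_diff_distrib)
      also have "\<dots> \<le> 2 * norm (s j h - ?e)"
        using elim(1) s_near by (intro norm_Ln_diff_le) (simp_all add: dist_norm)
      also have "\<dots> \<le> \<bar>h\<bar> * (2 * K * \<bar>h\<bar> ^ p)" using se by simp
      finally show ?case by (rule mult_left_le_imp_le) (use elim in simp)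
    qed
  qed
  have d0: "d j 0 = l j" for j
  proof -
    have "((\<lambda>h. d j h - l j) \<longlongrightarrow> 0) (at 0)"
    proof (rule Lim_null_comparison[OF _ tendsto_abs_power_zero[OF p]])
      show "\<forall>\<^sub>F h in at 0. norm (d j h - l j) \<le> 2 * K * \<bar>h\<bar> ^ p"
        using estd[of j] by simp
    qed
    then have "(d j \<longlongrightarrow> l j) (at 0)" by (simp add: LIM_zero_iff)
    moreover have "(d j \<longlongrightarrow> d j 0) (at 0)"
      using d(1)[of 0 j] by (simp add: continuous_on_def)
    ultimately show ?thesis by (metis tendsto_unique trivial_limit_at)
  qed
  define K' where "K' = max (CARD('n) * (CARD('n) * K)) (2 * K)"
  have K': "CARD('n) * (CARD('n) * K) * \<bar>h\<bar> ^ p \<le> K' * \<bar>h\<bar> ^ p"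
    "2 * K * \<bar>h\<bar> ^ p \<le> K' * \<bar>h\<bar> ^ p" for h
    unfolding K'_def by (auto intro!: mult_right_mono)
  show thesis
  proof (rule that[of d V a K'])
    show "\<forall>\<^sub>F h in at 0. norm (V h - V 0) \<le> K' * \<bar>h\<bar> ^ p"
      using estV by eventually_elim (rule order_trans[OF _ K'(1)])
    show "\<forall>\<^sub>F h in at 0. \<bar>d j h - d j 0\<bar> \<le> K' * \<bar>h\<bar> ^ p" for j
      unfolding d0 using estd[of j] by eventually_elim (rule order_trans[OF _ K'(2)])
  qed (use d(1) CV V_inv \<phi>(3) main in auto)
qed

section \<open>Smooth diagonalization by unimodular eigenvalues\<close>

theorem theorem3p2:
  fixes H :: "complex ^ 'n ^ 'n"
    and S :: "real \<Rightarrow> complex ^ 'n ^ 'n"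
    and p :: nat
  assumes "\<And>h. invertible (S h)"
    and "smooth S"
    and "\<And>h. eigenvalues (S h) = cnj ` inverse ` eigenvalues (S h)"
    and "p \<ge> 1"
    and "(\<lambda>h. norm (S h - matrix_exp (map_matrix (\<lambda>z. \<i> * of_real h * z) H)))
           \<in> O[at 0](\<lambda>h. h ^ (p + 1))"
    and "\<And>c. c \<in> eigenvalues H \<Longrightarrow> c \<in> \<real> \<and> simple_eigenvalue H c"
  shows "\<exists>(D :: real \<Rightarrow> real ^ 'n ^ 'n) (P :: real \<Rightarrow> complex ^ 'n ^ 'n).
           (\<forall>h. diagonal_matrix (D h)) \<and> smooth D \<and>
           (\<forall>h. invertible (P h)) \<and> smooth P \<and>
           (\<lambda>h. norm (P h - P 0)) \<in> O[at 0](\<lambda>h. h ^ p) \<and>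
           (\<lambda>h. norm (D h - D 0)) \<in> O[at 0](\<lambda>h. h ^ p) \<and>
           (\<exists>\<delta>>0. \<forall>h. \<bar>h\<bar> < \<delta> \<longrightarrow>
              S h = P h ** matrix_exp (map_matrix (\<lambda>d. \<i> * of_real h * of_real d) (D h))
                      ** matrix_inv (P h))"
proof -
  obtain f :: "'n \<Rightarrow> complex" and R where f: "inj f" "range f = eigenvalues H" and R: "invertible R"
    and H: "H = R ** diag_mat f ** matrix_inv R"
    using diagonalizable_if_simple[of H] assms(6) by metis
  define Q where "Q = matrix_inv R"
  have RQ: "R ** Q = mat 1" "Q ** R = mat 1"
    using matrix_inv_mult[OF R] by (simp_all add: Q_def)
  define l where "l j = Re (f j)" for j
  have f_real: "f j = of_real (l j)" for j
    using assms(6)[of "f j"] f(2) by (auto simp: l_def complex_is_Real_iff complex_eq_iff)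
  have l: "inj l" using f(1) by (auto simp: f_real inj_def)
  have expH: "matrix_exp (map_matrix (\<lambda>z. \<i> * of_real h * z) H)
      = R ** diag_mat (\<lambda>j. exp (\<i> * of_real h * of_real (l j))) ** Q" for h
  proof -
    have "map_matrix (\<lambda>z. \<i> * of_real h * z) H = R ** diag_mat (\<lambda>j. \<i> * of_real h * f j) ** Q"
      by (simp add: H Q_def vec_eq_iff matrix_matrix_mult_def diag_mat_def sum_distrib_left
          if_distrib ac_simps cong: if_cong)
    then show ?thesis by (simp add: matrix_exp_similar[OF RQ] f_real)
  qed
  \<comment> \<open>\<open>S\<close> in the eigenbasis of \<open>H\<close>\<close>
  define T where "T h = Q ** S h ** R" for h
  have bl: "bounded_linear (\<lambda>M. A ** M ** B)" for A B :: "complex ^ 'n ^ 'n"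
    using linear_matrix_mult by (simp add: linear_conv_bounded_linear)
  have blR: "bounded_linear (\<lambda>M :: complex ^ 'n ^ 'n. R ** M)"
    using bl[of R "mat 1"] by simp
  have S: "Ck k S" for k using assms(2) by (simp add: smooth_iff_Ck)
  have T: "Ck k T" for k
    unfolding T_def[abs_def] by (rule Ck_bounded_linear[OF bl S])
  obtain C where "C > 0" and C': "\<forall>\<^sub>F h in at 0.
      norm (norm (S h - matrix_exp (map_matrix (\<lambda>z. \<i> * of_real h * z) H))) \<le> C * norm (h ^ (p + 1))"
    by (rule landau_o.bigE[OF assms(5)])
  have C: "\<forall>\<^sub>F h in at 0.
      norm (S h - R ** diag_mat (\<lambda>j. exp (\<i> * of_real h * of_real (l j))) ** Q) \<le> C * \<bar>h\<bar> ^ (p + 1)"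
    using C' by (simp only: expH real_norm_def power_abs abs_norm_cancel)
  obtain L where L: "\<And>M. norm (Q ** M ** R) \<le> norm M * L" "L > 0"
    using bounded_linear.pos_bounded[OF bl[of Q R]] by auto
  have near: "\<forall>\<^sub>F h in at 0.
      norm (T h - diag_mat (\<lambda>j. exp (\<i> * of_real h * of_real (l j)))) \<le> (C * L) * \<bar>h\<bar> ^ (p + 1)"
    using C
  proof eventually_elim
    case (elim h)
    let ?E = "diag_mat (\<lambda>j. exp (\<i> * of_real h * of_real (l j)))"
    have "Q ** (R ** ?E ** Q) ** R = (Q ** R) ** ?E ** (Q ** R)"
      by (simp add: matrix_mul_assoc)
    then have "T h - ?E = Q ** (S h - R ** ?E ** Q) ** R"
      using linear_diff[OF linear_matrix_mult[of Q R], of "S h" "R ** ?E ** Q"]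
      by (simp add: T_def RQ)
    then have "norm (T h - ?E) \<le> norm (S h - R ** ?E ** Q) * L" using L(1) by simp
    also have "\<dots> \<le> (C * \<bar>h\<bar> ^ (p + 1)) * L" using elim L(2) by (intro mult_right_mono) auto
    finally show ?case by (simp add: ac_simps)
  qed
  have symm: "eigenvalues (T h) = cnj ` inverse ` eigenvalues (T h)" for h
  proof -
    have "S h ** R = R ** T h"
      by (simp add: T_def matrix_mul_assoc RQ)
    then have "eigenvalues (S h) = eigenvalues (T h)"
      by (rule eigenvalues_similar[OF R])
    with assms(3)[of h] show ?thesis by simp
  qed
  show ?thesis
  proof (rule diagonal_leading_part[OF T assms(4) l near symm])
    fix d :: "'n \<Rightarrow> real \<Rightarrow> real" and V :: "real \<Rightarrow> complex ^ 'n ^ 'n" and a K :: real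
    assume d: "\<And>j k. Ck k (d j)" and V: "\<And>k. Ck k V" "\<And>h. invertible (V h)" and a: "a > 0"
      and TV: "\<And>h. \<bar>h\<bar> < a \<Longrightarrow> T h ** V h = V h ** diag_mat (\<lambda>j. exp (\<i> * of_real h * of_real (d j h)))"
      and estV: "\<forall>\<^sub>F h in at 0. norm (V h - V 0) \<le> K * \<bar>h\<bar> ^ p"
      and estd: "\<And>j. \<forall>\<^sub>F h in at 0. \<bar>d j h - d j 0\<bar> \<le> K * \<bar>h\<bar> ^ p"
    define P where "P h = R ** V h" for h
    define D where "D h = diag_mat (\<lambda>j. d j h)" for h
    have P: "invertible (P h)" for h
      unfolding P_def using invertible_mult[OF R V(2)] .
    show ?thesis
    proof (rule exI[of _ D], rule exI[of _ P], intro conjI allI)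
      show "diagonal_matrix (D h)" for h
        by (simp add: diagonal_matrix_def D_def diag_mat_def)
      show "smooth D"
        unfolding smooth_iff_Ck
      proof
        fix k
        have "Ck k (\<lambda>h. if i = j then d i h else 0)" for i j
          using d by (cases "i = j") auto
        then show "Ck k D"
          unfolding D_def[abs_def] diag_mat_def by (intro Ck_vec_lambda)
      qed
      show "invertible (P h)" for h by (rule P)
      show "smooth P"
        unfolding smooth_iff_Ck P_def[abs_def] by (intro allI Ck_bounded_linear[OF blR V(1)])
      obtain L' where L': "\<And>M :: complex ^ 'n ^ 'n. norm (R ** M) \<le> norm M * L'" "L' > 0"
        using bounded_linear.pos_bounded[OF blR] by metis
      show "(\<lambda>h. norm (P h - P 0)) \<in> O[at 0](\<lambda>h. h ^ p)"
      proof (rule bigoI[where c = "K * L'"])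
        show "\<forall>\<^sub>F h in at 0. norm (norm (P h - P 0)) \<le> K * L' * norm (h ^ p)"
          using estV
        proof eventually_elim
          case (elim h)
          have "P h - P 0 = R ** (V h - V 0)"
            unfolding P_def using linear_diff[OF bounded_linear.linear[OF blR]] by metis
          then have "norm (P h - P 0) \<le> norm (V h - V 0) * L'" using L'(1) by simp
          also have "\<dots> \<le> (K * \<bar>h\<bar> ^ p) * L'" using elim L'(2) by (intro mult_right_mono) auto
          finally show ?case by (simp add: power_abs ac_simps)
        qed
      qed
      show "(\<lambda>h. norm (D h - D 0)) \<in> O[at 0](\<lambda>h. h ^ p)"
      proof (rule bigoI[where c = "CARD('n) * (CARD('n) * K)"])
        have "\<forall>\<^sub>F h in at 0. \<forall>j. \<bar>d j h - d j 0\<bar> \<le> K * \<bar>h\<bar> ^ p"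
          using estd by (rule eventually_all_finite)
        then show "\<forall>\<^sub>F h in at 0. norm (norm (D h - D 0)) \<le> CARD('n) * (CARD('n) * K) * norm (h ^ p)"
        proof eventually_elim
          case (elim h)
          have "0 \<le> K * \<bar>h\<bar> ^ p" using order_trans[OF abs_ge_zero elim[rule_format]] .
          then have "norm ((D h - D 0) $ i $ j) \<le> K * \<bar>h\<bar> ^ p" for i j
            using elim by (simp add: D_def diag_mat_def)
          then have "norm (D h - D 0) \<le> CARD('n) * (CARD('n) * (K * \<bar>h\<bar> ^ p))"
            by (intro norm_le_card_mult)
          then show ?case by (simp add: power_abs mult.assoc)
        qed
      qed
      show "\<exists>\<delta>>0. \<forall>h. \<bar>h\<bar> < \<delta> \<longrightarrow>
                S h = P h ** matrix_exp (map_matrix (\<lambda>d. \<i> * of_real h * of_real d) (D h)) ** matrix_inv (P h)"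
      proof (intro exI conjI allI impI)
        fix h assume h: "\<bar>h\<bar> < a"
        let ?s = "\<lambda>j. exp (\<i> * of_real h * of_real (d j h))"
        have "map_matrix (\<lambda>d. \<i> * of_real h * of_real d) (D h) = diag_mat (\<lambda>j. \<i> * of_real h * of_real (d j h))"
          by (simp add: vec_eq_iff D_def diag_mat_def)
        then have E: "matrix_exp (map_matrix (\<lambda>d. \<i> * of_real h * of_real d) (D h)) = diag_mat ?s"
          by (simp add: matrix_exp_diag_mat)
        have "S h ** P h = (R ** Q) ** S h ** R ** V h" by (simp add: P_def RQ matrix_mul_assoc)
        also have "\<dots> = R ** (T h ** V h)" by (simp add: T_def matrix_mul_assoc)
        also have "\<dots> = P h ** diag_mat ?s" by (simp add: TV[OF h] P_def matrix_mul_assoc)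
        finally have "S h ** P h = P h ** diag_mat ?s" .
        moreover have "S h = S h ** P h ** matrix_inv (P h)"
          using matrix_inv_mult(1)[OF P] by (simp flip: matrix_mul_assoc)
        ultimately show "S h = P h ** matrix_exp (map_matrix (\<lambda>d. \<i> * of_real h * of_real d) (D h)) ** matrix_inv (P h)"
          by (simp add: E)
      qed (fact a)
    qed
  qed
qed

end
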